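(* Let $t\in\mathbb{T}$ and $x\in L^2_{\mathcal F}(t;\mathbb{R}^n)$. The following statements are equivalent. (i) There exists an open-loop equilibrium pair of Problem (LQ) for the initial pair $(t,x)$. (ii) There exists $u^{t,x,*}\in L^2_{\mathcal F}(\mathbb{T}_t;\mathbb{R}^m)$ such that for every $k\in\mathbb{T}_t$ the forward-backward stochastic difference equation $$\begin{cases} X^{k,t,x}_{\ell+1}=\big(A_{k,\ell}X^{k,t,x}_\ell+\bar A_{k,\ell}\mathbb{E}_kX^{k,t,x}_\ell+B_{k,\ell}u^{t,x,*}_\ell+\bar B_{k,\ell}\mathbb{E}_ku^{t,x,*}_\ell+f_{k,\ell}\big)\\ \qquad\quad+\big(C_{k,\ell}X^{k,t,x}_\ell+\bar C_{k,\ell}\mathbb{E}_kX^{k,t,x}_\ell+D_{k,\ell}u^{t,x,*}_\ell+\bar D_{k,\ell}\mathbb{E}_ku^{t,x,*}_\ell+d_{k,\ell}\big)w_\ell,\\ Z^{k,t,x}_\ell=A_{k,\ell}^T\mathbb{E}_\ell Z^{k,t,x}_{\ell+1}+\bar A_{k,\ell}^T\mathbb{E}_kZ^{k,t,x}_{\ell+1}+C_{k,\ell}^T\mathbb{E}_\ell(Z^{k,t,x}_{\ell+1}w_\ell)+\bar C_{k,\ell}^T\mathbb{E}_k(Z^{k,t,x}_{\ell+1}w_\ell)\\ \qquad\quad+Q_{k,\ell}X^{k,t,x}_\ell+\bar Q_{k,\ell}\mathbb{E}_kX^{k,t,x}_\ell+q_{k,\ell},\\ X^{k,t,x}_k=X^{t,x,*}_k,\quad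 Z^{k,t,x}_N=G_kX^{k,t,x}_N+\bar G_k\mathbb{E}_kX^{k,t,x}_N+g_k,\quad \ell\in\mathbb{T}_k \end{cases}$$ admits a solution $(X^{k,t,x},Z^{k,t,x})$ satisfying the stationary condition $$0=(R_{k,k}+\bar R_{k,k})u^{t,x,*}_k+(B_{k,k}+\bar B_{k,k})^T\mathbb{E}_kZ^{k,t,x}_{k+1}+(D_{k,k}+\bar D_{k,k})^T\mathbb{E}_k(Z^{k,t,x}_{k+1}w_k)+\rho_{k,k},$$ and the convexity condition $$\inf_{\bar u_k\in L^2_{\mathcal F}(k;\mathbb{R}^m)}\widehat J(k,0;\bar u_k)\ge 0$$ holds (that is, $\widehat J(k,0;\bar u_k)\ge0$ almost surely for every $\bar u_k\in L^2_{\mathcal F}(k;\mathbb{R}^m)$). Here $X^{t,x,*}$ is given by $$\begin{cases} X^{t,x,*}_{k+1}=\big[(A_{k,k}+\bar A_{k,k})X^{t,x,*}_k+(B_{k,k}+\bar B_{k,k})u^{t,x,*}_k+f_{k,k}\big]\\ \qquad\quad+\big[(C_{k,k}+\bar C_{k,k})X^{t,x,*}_k+(D_{k,k}+\bar D_{k,k})u^{t,x,*}_k+d_{k,k}\big]w_k,\\ X^{t,x,*}_t=x,\quad k\in\mathbb{T}_t. \end{cases}$$ Under any of these conditions, $(X^{t,x,*},u^{t,x,*})$ given in (ii) is an open-loop equilibrium pair for the initial pair $(t,x)$.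
   Context: **Setting.** $N,n,m$ are positive integers; $\mathbb{T}=\{0,\dots,N-1\}$, $\mathbb{T}_t=\{t,\dots,N-1\}$ (empty for $t=N$). $\{w_k,k\in\mathbb{T}\}$ is a real martingale difference sequence on a probability space $(\Omega,\mathcal F,P)$; $\mathcal F_k=\sigma\{w_0,\dots,w_{k-1}\}$, $\mathcal F_0=\{\emptyset,\Omega\}$, $\mathbb{E}_k=\mathbb{E}[\,\cdot\,|\mathcal F_k]$, and $\mathbb{E}_k[w_k]=0$, $\mathbb{E}_k[w_k^2]=1$ for $k\in\mathbb{T}$. $L^2_{\mathcal F}(k;\mathcal H)$ is the set of $\mathcal F_k$-measurable square-integrable $\mathcal H$-valued random variables; $L^2_{\mathcal F}(\mathbb{T}_t;\mathcal H)$ is the set of processes $\nu=\{\nu_k,k\in\mathbb{T}_t\}$ with $\nu_k$ $\mathcal F_k$-measurable and $\sum_{k=t}^{N-1}\mathbb{E}|\nu_k|^2<\infty$. Relations between random variables hold almost surely. For $t\in\mathbb{T}$, $k\in\mathbb{T}_t$ the following deterministic data are given: $A_{t,k},\bar A_{t,k},C_{t,k},\bar C_{t,k}\in\mathbb{R}^{n\times n}$; $B_{t,k},\bar B_{t,k},D_{t,k},\bar D_{t,k}\in\mathbb{R}^{n\times m}$; $f_{t,k},d_{t,k},q_{t,k},g_t\in\mathbb{R}^n$; $\rho_{t,k}\in\mathbb{R}^m$; symmetric $Q_{t,k},\bar Q_{t,k},G_t,\bar G_t\in\mathbb{R}^{n\times n}$ and $R_{t,k},\bar R_{t,k}\in\mathbb{R}^{m\times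 m}$ (no definiteness assumed). For $t\in\mathbb{T}$, $x\in L^2_{\mathcal F}(t;\mathbb{R}^n)$, $u\in L^2_{\mathcal F}(\mathbb{T}_t;\mathbb{R}^m)$, the state $X^t$ solves, for $k\in\mathbb{T}_t$, $X^t_t=x$ and $$X^t_{k+1}=\big(A_{t,k}X^t_k+\bar A_{t,k}\mathbb{E}_tX^t_k+B_{t,k}u_k+\bar B_{t,k}\mathbb{E}_tu_k+f_{t,k}\big)+\big(C_{t,k}X^t_k+\bar C_{t,k}\mathbb{E}_tX^t_k+D_{t,k}u_k+\bar D_{t,k}\mathbb{E}_tu_k+d_{t,k}\big)w_k,$$ and the cost is $$J(t,x;u)=\sum_{k=t}^{N-1}\mathbb{E}_t\big\{(X^t_k)^TQ_{t,k}X^t_k+(\mathbb{E}_tX^t_k)^T\bar Q_{t,k}\mathbb{E}_tX^t_k+u_k^TR_{t,k}u_k+(\mathbb{E}_tu_k)^T\bar R_{t,k}\mathbb{E}_tu_k+2q_{t,k}^TX^t_k+2\rho_{t,k}^Tu_k\big\}$$ $$+\mathbb{E}_t[(X^t_N)^TG_tX^t_N]+(\mathbb{E}_tX^t_N)^T\bar G_t\mathbb{E}_tX^t_N+2\mathbb{E}_t[g_t^TX^t_N].$$ Problem (LQ) is the (time-inconsistent) problem of minimizing $J(t,x;\cdot)$ over $L^2_{\mathcal F}(\mathbb{T}_t;\mathbb{R}^m)$. **Open-loop equilibrium pair.** A pair $(X^{t,x,*},u^{t,x,*})$ with $u^{t,x,*}\in L^2_{\mathcal F}(\mathbb{T}_t;\mathbb{R}^m)$,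 whose state satisfies $X^{t,x,*}_t=x$ and, for $k\in\mathbb{T}_t$, $$X^{t,x,*}_{k+1}=[(A_{k,k}+\bar A_{k,k})X^{t,x,*}_k+(B_{k,k}+\bar B_{k,k})u^{t,x,*}_k+f_{k,k}]+[(C_{k,k}+\bar C_{k,k})X^{t,x,*}_k+(D_{k,k}+\bar D_{k,k})u^{t,x,*}_k+d_{k,k}]w_k,$$ is an open-loop equilibrium pair of Problem (LQ) for $(t,x)$ if for every $k\in\mathbb{T}_t$ and every $u_k\in L^2_{\mathcal F}(k;\mathbb{R}^m)$, $$J(k,X^{t,x,*}_k;u^{t,x,*}|_{\mathbb{T}_k})\le J(k,X^{t,x,*}_k;(u_k,u^{t,x,*}|_{\mathbb{T}_{k+1}})),$$ where $|_{\mathbb{T}_k}$ denotes restriction to $\mathbb{T}_k$. **The functional $\widehat J$.** For $k\in\mathbb{T}$, $\bar u_k\in L^2_{\mathcal F}(k;\mathbb{R}^m)$, let $Y^{k,\bar u_k}$ be defined by $Y^{k,\bar u_k}_k=0$, $Y^{k,\bar u_k}_{k+1}=(B_{k,k}+\bar B_{k,k})\bar u_k+(D_{k,k}+\bar D_{k,k})\bar u_kw_k$, and for $\ell\in\mathbb{T}_{k+1}$, $Y^{k,\bar u_k}_{\ell+1}=A_{k,\ell}Y^{k,\bar u_k}_\ell+\bar A_{k,\ell}\mathbb{E}_kY^{k,\bar u_k}_\ell+(C_{k,\ell}Y^{k,\bar u_k}_\ell+\bar C_{k,\ell}\mathbb{E}_kY^{k,\bar u_k}_\ell)w_\ell$.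 Then $$\widehat J(k,0;\bar u_k)=\sum_{\ell=k}^{N-1}\mathbb{E}_k\big[(Y^{k,\bar u_k}_\ell)^TQ_{k,\ell}Y^{k,\bar u_k}_\ell+(\mathbb{E}_kY^{k,\bar u_k}_\ell)^T\bar Q_{k,\ell}\mathbb{E}_kY^{k,\bar u_k}_\ell\big]+\bar u_k^T(R_{k,k}+\bar R_{k,k})\bar u_k$$ $$+\mathbb{E}_k[(Y^{k,\bar u_k}_N)^TG_kY^{k,\bar u_k}_N]+(\mathbb{E}_kY^{k,\bar u_k}_N)^T\bar G_k\mathbb{E}_kY^{k,\bar u_k}_N.$$ *)

theory Defs
  imports "HOL-Probability.Probability"
begin

text \<open>
  The state space is \<open>real ^ 'n\<close> and the control space is \<open>real ^ 'm\<close>. A suffix \<open>b\<close> marks the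
  barred coefficients, which multiply conditional expectations. All coefficients are deterministic
  and indexed by the initial time \<open>t\<close> and the current time \<open>k\<close>; the terminal weights depend on
  \<open>t\<close> only. Only the values with \<open>t < N\<close> and \<open>t \<le> k < N\<close> are ever used.
\<close>

record ('n::finite, 'm::finite) lq_data =
  cA   :: "nat \<Rightarrow> nat \<Rightarrow> real ^ 'n ^ 'n"
  cAb  :: "nat \<Rightarrow> nat \<Rightarrow> real ^ 'n ^ 'n"
  cB   :: "nat \<Rightarrow> nat \<Rightarrow> real ^ 'm ^ 'n"
  cBb  :: "nat \<Rightarrow> nat \<Rightarrow> real ^ 'm ^ 'n"
  cC   :: "nat \<Rightarrow> nat \<Rightarrow> real ^ 'n ^ 'n"
  cCb  :: "nat \<Rightarrow> nat \<Rightarrow> real ^ 'n ^ 'n"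
  cD   :: "nat \<Rightarrow> nat \<Rightarrow> real ^ 'm ^ 'n"
  cDb  :: "nat \<Rightarrow> nat \<Rightarrow> real ^ 'm ^ 'n"
  cf   :: "nat \<Rightarrow> nat \<Rightarrow> real ^ 'n"
  cd   :: "nat \<Rightarrow> nat \<Rightarrow> real ^ 'n"
  cQ   :: "nat \<Rightarrow> nat \<Rightarrow> real ^ 'n ^ 'n"
  cQb  :: "nat \<Rightarrow> nat \<Rightarrow> real ^ 'n ^ 'n"
  cR   :: "nat \<Rightarrow> nat \<Rightarrow> real ^ 'm ^ 'm"
  cRb  :: "nat \<Rightarrow> nat \<Rightarrow> real ^ 'm ^ 'm"
  cq   :: "nat \<Rightarrow> nat \<Rightarrow> real ^ 'n"
  crho :: "nat \<Rightarrow> nat \<Rightarrow> real ^ 'm"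
  cG   :: "nat \<Rightarrow> real ^ 'n ^ 'n"
  cGb  :: "nat \<Rightarrow> real ^ 'n ^ 'n"
  cg   :: "nat \<Rightarrow> real ^ 'n"

definition symmetric_weights :: "nat \<Rightarrow> ('n::finite, 'm::finite) lq_data \<Rightarrow> bool" where
  "symmetric_weights N P \<longleftrightarrow>
     (\<forall>t<N. transpose (cG P t) = cG P t \<and> transpose (cGb P t) = cGb P t \<and>
        (\<forall>k\<in>{t..<N}.
           transpose (cQ P t k) = cQ P t k \<and> transpose (cQb P t k) = cQb P t k \<and>
           transpose (cR P t k) = cR P t k \<and> transpose (cRb P t k) = cRb P t k))"

text \<open>The sigma-algebra generated by \<open>w 0, \<dots>, w (k - 1)\<close>; trivial for \<open>k = 0\<close>. It is not completed.\<close>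

definition noise_filtration :: "'a measure \<Rightarrow> (nat \<Rightarrow> 'a \<Rightarrow> real) \<Rightarrow> nat \<Rightarrow> 'a measure" where
  "noise_filtration M w k =
     sigma (space M) (\<Union>i<k. {w i -` S \<inter> space M | S. S \<in> sets borel})"

text \<open>Conditional expectation of random vectors, componentwise.\<close>

definition vec_cond_exp ::
    "'a measure \<Rightarrow> 'a measure \<Rightarrow> ('a \<Rightarrow> real ^ 'd::finite) \<Rightarrow> 'a \<Rightarrow> real ^ 'd" where
  "vec_cond_exp M F X = (\<lambda>\<omega>. \<chi> i. real_cond_exp M F (\<lambda>\<omega>'. X \<omega>' $ i) \<omega>)"

definition quad :: "real ^ 'd ^ 'd \<Rightarrow> real ^ 'd \<Rightarrow> real" where
  "quad S v = v \<bullet> (S *v v)"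

locale lq_problem = prob_space M
  for M :: "'a measure" +
  fixes N :: nat
    and w :: "nat \<Rightarrow> 'a \<Rightarrow> real"
    and P :: "('n::finite, 'm::finite) lq_data"
  assumes horizon_pos: "N > 0"
    and noise_measurable: "\<And>k. k < N \<Longrightarrow> w k \<in> borel_measurable M"
    and noise_square_integrable: "\<And>k. k < N \<Longrightarrow> integrable M (\<lambda>\<omega>. (w k \<omega>)\<^sup>2)"
    and noise_mean:
      "\<And>k. k < N \<Longrightarrow> AE \<omega> in M. real_cond_exp M (noise_filtration M w k) (w k) \<omega> = 0"
    and noise_variance:
      "\<And>k. k < N \<Longrightarrow>
        AE \<omega> in M. real_cond_exp M (noise_filtration M w k) (\<lambda>\<omega>'. (w k \<omega>')\<^sup>2) \<omega> = 1"
    and symmetric: "symmetric_weights N P"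
begin

abbreviation Filt :: "nat \<Rightarrow> 'a measure" where
  "Filt k \<equiv> noise_filtration M w k"

abbreviation EE :: "nat \<Rightarrow> ('a \<Rightarrow> real ^ 'd::finite) \<Rightarrow> 'a \<Rightarrow> real ^ 'd" where
  "EE k \<equiv> vec_cond_exp M (Filt k)"

abbreviation EE1 :: "nat \<Rightarrow> ('a \<Rightarrow> real) \<Rightarrow> 'a \<Rightarrow> real" where
  "EE1 k \<equiv> real_cond_exp M (Filt k)"

definition L2 :: "nat \<Rightarrow> ('a \<Rightarrow> real ^ 'd::finite) set" where
  "L2 k = {X. X \<in> borel_measurable (Filt k) \<and> integrable M (\<lambda>\<omega>. (norm (X \<omega>))\<^sup>2)}"

text \<open>
  Processes are total functions of time, and only their values on the time set \<open>T\<close> matter. As \<open>T\<close>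
  is always finite, finiteness of the sum of the second moments is finiteness of each of them.
\<close>

definition L2_proc :: "nat set \<Rightarrow> (nat \<Rightarrow> 'a \<Rightarrow> real ^ 'd::finite) set" where
  "L2_proc T = {X. \<forall>k\<in>T. X k \<in> L2 k}"

text \<open>
  Right-hand side of the state equation at time \<open>k\<close> for the coefficients of the initial time \<open>t\<close>,
  when the current state and control are \<open>x\<close> and \<open>v\<close>.
\<close>

definition state_step ::
    "nat \<Rightarrow> nat \<Rightarrow> ('a \<Rightarrow> real ^ 'n) \<Rightarrow> ('a \<Rightarrow> real ^ 'm) \<Rightarrow> 'a \<Rightarrow> real ^ 'n" where
  "state_step t k x v = (\<lambda>\<omega>.
     (cA P t k *v x \<omega> + cAb P t k *v EE t x \<omega> + cB P t k *v v \<omega> + cBb P t k *v EE t v \<omega> + cf P t k)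
     + w k \<omega> *\<^sub>R
     (cC P t k *v x \<omega> + cCb P t k *v EE t x \<omega> + cD P t k *v v \<omega> + cDb P t k *v EE t v \<omega> + cd P t k))"

text \<open>The controlled state started at time \<open>t\<close>; the values before time \<open>t\<close> are irrelevant.\<close>

primrec state ::
    "nat \<Rightarrow> ('a \<Rightarrow> real ^ 'n) \<Rightarrow> (nat \<Rightarrow> 'a \<Rightarrow> real ^ 'm) \<Rightarrow> nat \<Rightarrow> 'a \<Rightarrow> real ^ 'n" where
  "state t x u 0 = x"
| "state t x u (Suc k) = (if k < t then x else state_step t k (state t x u k) (u k))"

definition cost ::
    "nat \<Rightarrow> ('a \<Rightarrow> real ^ 'n) \<Rightarrow> (nat \<Rightarrow> 'a \<Rightarrow> real ^ 'm) \<Rightarrow> 'a \<Rightarrow> real" where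
  "cost t x u = (let X = state t x u in (\<lambda>\<omega>.
     (\<Sum>k = t..<N. EE1 t (\<lambda>\<omega>'.
          quad (cQ P t k) (X k \<omega>') + quad (cQb P t k) (EE t (X k) \<omega>')
        + quad (cR P t k) (u k \<omega>') + quad (cRb P t k) (EE t (u k) \<omega>')
        + 2 * (cq P t k \<bullet> X k \<omega>') + 2 * (crho P t k \<bullet> u k \<omega>')) \<omega>)
     + EE1 t (\<lambda>\<omega>'. quad (cG P t) (X N \<omega>')) \<omega>
     + quad (cGb P t) (EE t (X N) \<omega>)
     + 2 * EE1 t (\<lambda>\<omega>'. cg P t \<bullet> X N \<omega>') \<omega>))"

text \<open>
  \<open>X\<close> is the state under \<open>u\<close> when at each time the coefficients of the current time are used.
\<close>

definition equilibrium_state ::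
    "nat \<Rightarrow> ('a \<Rightarrow> real ^ 'n) \<Rightarrow> (nat \<Rightarrow> 'a \<Rightarrow> real ^ 'm) \<Rightarrow> (nat \<Rightarrow> 'a \<Rightarrow> real ^ 'n) \<Rightarrow> bool" where
  "equilibrium_state t x u X \<longleftrightarrow>
     X \<in> L2_proc {t..N} \<and>
     (AE \<omega> in M. X t \<omega> = x \<omega>) \<and>
     (\<forall>k\<in>{t..<N}. AE \<omega> in M. X (Suc k) \<omega> =
        ((cA P k k + cAb P k k) *v X k \<omega> + (cB P k k + cBb P k k) *v u k \<omega> + cf P k k)
        + w k \<omega> *\<^sub>R
        ((cC P k k + cCb P k k) *v X k \<omega> + (cD P k k + cDb P k k) *v u k \<omega> + cd P k k))"

definition open_loop_equilibrium_pair ::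
    "nat \<Rightarrow> ('a \<Rightarrow> real ^ 'n) \<Rightarrow> (nat \<Rightarrow> 'a \<Rightarrow> real ^ 'n) \<Rightarrow> (nat \<Rightarrow> 'a \<Rightarrow> real ^ 'm) \<Rightarrow> bool" where
  "open_loop_equilibrium_pair t x X u \<longleftrightarrow>
     u \<in> L2_proc {t..<N} \<and> equilibrium_state t x u X \<and>
     (\<forall>k\<in>{t..<N}. \<forall>v\<in>L2 k.
        AE \<omega> in M. cost k (X k) u \<omega> \<le> cost k (X k) (u(k := v)) \<omega>)"

text \<open>
  The response to a control acting at time \<open>k\<close> only, in the homogeneous system started from 0;
  the values before time \<open>k\<close> are irrelevant.
\<close>

primrec pert_state :: "nat \<Rightarrow> ('a \<Rightarrow> real ^ 'm) \<Rightarrow> nat \<Rightarrow> 'a \<Rightarrow> real ^ 'n" where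
  "pert_state k v 0 = (\<lambda>\<omega>. 0)"
| "pert_state k v (Suc l) =
     (if l < k then (\<lambda>\<omega>. 0)
      else if l = k then (\<lambda>\<omega>.
        (cB P k k + cBb P k k) *v v \<omega> + w k \<omega> *\<^sub>R ((cD P k k + cDb P k k) *v v \<omega>))
      else (\<lambda>\<omega>.
        (cA P k l *v pert_state k v l \<omega> + cAb P k l *v EE k (pert_state k v l) \<omega>)
        + w l \<omega> *\<^sub>R
        (cC P k l *v pert_state k v l \<omega> + cCb P k l *v EE k (pert_state k v l) \<omega>)))"

definition pert_cost :: "nat \<Rightarrow> ('a \<Rightarrow> real ^ 'm) \<Rightarrow> 'a \<Rightarrow> real" where
  "pert_cost k v = (let Y = pert_state k v in (\<lambda>\<omega>.
     (\<Sum>l = k..<N. EE1 k (\<lambda>\<omega>'. quad (cQ P k l) (Y l \<omega>') + quad (cQb P k l) (EE k (Y l) \<omega>')) \<omega>)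
     + quad (cR P k k + cRb P k k) (v \<omega>)
     + EE1 k (\<lambda>\<omega>'. quad (cG P k) (Y N \<omega>')) \<omega>
     + quad (cGb P k) (EE k (Y N) \<omega>)))"

definition fbsde_solution ::
    "nat \<Rightarrow> ('a \<Rightarrow> real ^ 'n) \<Rightarrow> (nat \<Rightarrow> 'a \<Rightarrow> real ^ 'm) \<Rightarrow>
     (nat \<Rightarrow> 'a \<Rightarrow> real ^ 'n) \<Rightarrow> (nat \<Rightarrow> 'a \<Rightarrow> real ^ 'n) \<Rightarrow> bool" where
  "fbsde_solution k \<xi> u X Z \<longleftrightarrow>
     X \<in> L2_proc {k..N} \<and> Z \<in> L2_proc {k..N} \<and>
     (\<forall>l\<in>{k..<N}. AE \<omega> in M. X (Suc l) \<omega> = state_step k l (X l) (u l) \<omega>) \<and>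
     (\<forall>l\<in>{k..<N}. AE \<omega> in M. Z l \<omega> =
          transpose (cA P k l) *v EE l (Z (Suc l)) \<omega>
        + transpose (cAb P k l) *v EE k (Z (Suc l)) \<omega>
        + transpose (cC P k l) *v EE l (\<lambda>\<omega>'. w l \<omega>' *\<^sub>R Z (Suc l) \<omega>') \<omega>
        + transpose (cCb P k l) *v EE k (\<lambda>\<omega>'. w l \<omega>' *\<^sub>R Z (Suc l) \<omega>') \<omega>
        + cQ P k l *v X l \<omega> + cQb P k l *v EE k (X l) \<omega> + cq P k l) \<and>
     (AE \<omega> in M. X k \<omega> = \<xi> \<omega>) \<and>
     (AE \<omega> in M. Z N \<omega> = cG P k *v X N \<omega> + cGb P k *v EE k (X N) \<omega> + cg P k)"

definition stationary ::
    "nat \<Rightarrow> (nat \<Rightarrow> 'a \<Rightarrow> real ^ 'm) \<Rightarrow> (nat \<Rightarrow> 'a \<Rightarrow> real ^ 'n) \<Rightarrow> bool" where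
  "stationary k u Z \<longleftrightarrow>
     (AE \<omega> in M. 0 =
          (cR P k k + cRb P k k) *v u k \<omega>
        + transpose (cB P k k + cBb P k k) *v EE k (Z (Suc k)) \<omega>
        + transpose (cD P k k + cDb P k k) *v EE k (\<lambda>\<omega>'. w k \<omega>' *\<^sub>R Z (Suc k) \<omega>') \<omega>
        + crho P k k)"

text \<open>Nonnegativity of the infimum of a family of random variables, read almost surely.\<close>

definition convexity :: "nat \<Rightarrow> bool" where
  "convexity k \<longleftrightarrow> (\<forall>v\<in>L2 k. AE \<omega> in M. 0 \<le> pert_cost k v \<omega>)"

definition fbsde_conditions ::
    "nat \<Rightarrow> ('a \<Rightarrow> real ^ 'n) \<Rightarrow> (nat \<Rightarrow> 'a \<Rightarrow> real ^ 'n) \<Rightarrow> (nat \<Rightarrow> 'a \<Rightarrow> real ^ 'm) \<Rightarrow> bool" where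
  "fbsde_conditions t x X u \<longleftrightarrow>
     u \<in> L2_proc {t..<N} \<and> equilibrium_state t x u X \<and>
     (\<forall>k\<in>{t..<N}. (\<exists>Xk Zk. fbsde_solution k (X k) u Xk Zk \<and> stationary k u Zk) \<and> convexity k)"

end

end

theory Submission
  imports Defs
begin

text \<open>
  Replacing \<open>u k\<close> by \<open>u k + c v\<close> moves the state started at time \<open>k\<close> by \<open>c Y\<close>, where \<open>Y\<close> is the
  homogeneous response to \<open>v\<close>, so the cost at time \<open>k\<close> is a quadratic polynomial in \<open>c\<close>. The adjoint
  process \<open>Z\<close> and summation by parts turn its linear coefficient into \<open>2 v \<bullet> S\<close>, where \<open>S\<close> is the
  right-hand side of the stationarity condition; the quadratic coefficient is the perturbation cost of \<open>v\<close>.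
  Such a polynomial is minimal at \<open>c = 0\<close> for all \<open>v\<close> and \<open>c\<close> iff \<open>S = 0\<close> and the perturbation
  cost is nonnegative. To get \<open>S = 0\<close> almost surely, take \<open>v = S\<close> and \<open>c = - 1 / n\<close>. The backward
  equation for \<open>Z\<close> is always solvable, because the states do not depend on \<open>Z\<close>.
\<close>

text \<open>The noise is controlled only through its conditional moments, so
  \<open>w l *\<^sub>R Z\<close> is a priori merely integrable when \<open>Z\<close> is square
  integrable. Two estimates meet this obstacle. If \<open>f\<close> is known before the noise, then
  \<open>f * w l\<close> has the same second moment as \<open>f\<close>. And the square of the
  conditional expectation of \<open>w l * Z\<close> is at most the conditional expectation of the
  square of \<open>Z\<close>, a conditional Cauchy-Schwarz inequality; this keeps the adjoint
  process in \<open>L2\<close>. Summation by parts is not an identity between random variables: it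
  holds only under the conditional expectation at time \<open>k\<close>. Costs are therefore
  compared through their integrands, by a relation of equal conditional expectations, and almost
  sure equality is recovered at the end because both sides are known at time \<open>k\<close>. The
  inequality expressing minimality has an exceptional null set that depends on \<open>v\<close> and
  \<open>c\<close>. This is why \<open>S = 0\<close> is obtained from a single \<open>v\<close> and
  countably many \<open>c\<close>.\<close>

section \<open>Second moments under a noise of conditional variance one\<close>

lemma abs_mult_le_sum_squares: "\<bar>x * y\<bar> \<le> x\<^sup>2 + y\<^sup>2" for x y :: real
proof -
  have "0 \<le> (\<bar>x\<bar> - \<bar>y\<bar>)\<^sup>2" by simp
  then have "2 * (\<bar>x\<bar> * \<bar>y\<bar>) \<le> x\<^sup>2 + y\<^sup>2" unfolding power2_diff by simp
  moreover have "0 \<le> \<bar>x\<bar> * \<bar>y\<bar>" by simp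
  ultimately show ?thesis by (simp only: abs_mult)
qed

text \<open>Conditioning on \<open>F\<close> shows that the squares of \<open>f * g\<close> and of
  \<open>f\<close> have the same integral. Since integrability of the product is the claim itself,
  the computation runs in the extended nonnegative reals.\<close>

lemma (in sigma_finite_subalgebra) integrable_mult_square:
  fixes f g :: "'a \<Rightarrow> real"
  assumes f: "f \<in> borel_measurable F" "integrable M (\<lambda>x. (f x)\<^sup>2)"
    and g: "g \<in> borel_measurable M" "integrable M (\<lambda>x. (g x)\<^sup>2)"
    and one: "AE x in M. real_cond_exp M F (\<lambda>x. (g x)\<^sup>2) x = 1"
  shows "integrable M (\<lambda>x. (f x * g x)\<^sup>2)"
proof -
  note [measurable] = f(1) g(1)
  have fM [measurable]: "f \<in> borel_measurable M"
    using measurable_from_subalg[OF subalg f(1)] .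
  \<comment> \<open>The hypothesis on \<open>real_cond_exp\<close> is transferred to
    \<open>nn_cond_exp\<close> by comparing integrals over the sets of \<open>F\<close>. The
    nonnegative version lets the square of \<open>f\<close> be pulled out with no integrability
    condition.\<close>
  have "AE x in M. 1 = nn_cond_exp M F (\<lambda>x. ennreal ((g x)\<^sup>2)) x"
  proof (rule nn_cond_exp_charact)
    fix A assume A: "A \<in> sets F"
    then have AM [measurable]: "A \<in> sets M" using subalg unfolding subalgebra_def by auto
    have I: "integrable M (\<lambda>x. indicator A x * (g x)\<^sup>2)"
      using integrable_real_mult_indicator[OF AM g(2)] by (simp add: mult.commute)
    have A': "indicator A \<in> borel_measurable F" using A by simp
    have I': "integrable M (\<lambda>x. indicator A x * real_cond_exp M F (\<lambda>x. (g x)\<^sup>2) x)"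
      by (rule real_cond_exp_intg(1)[OF I A']) simp
    have "(\<integral>\<^sup>+x\<in>A. ennreal ((g x)\<^sup>2) \<partial>M) = (\<integral>\<^sup>+x. ennreal (indicator A x * (g x)\<^sup>2) \<partial>M)"
      by (intro nn_integral_cong) (auto split: split_indicator)
    also have "\<dots> = ennreal (\<integral>x. indicator A x * (g x)\<^sup>2 \<partial>M)"
      by (rule nn_integral_eq_integral[OF I]) simp
    also have "(\<integral>x. indicator A x * (g x)\<^sup>2 \<partial>M)
        = (\<integral>x. indicator A x * real_cond_exp M F (\<lambda>x. (g x)\<^sup>2) x \<partial>M)"
      by (rule real_cond_exp_intg(2)[OF I A', symmetric]) simp
    also have "ennreal \<dots> = (\<integral>\<^sup>+x. ennreal (indicator A x * real_cond_exp M F (\<lambda>x. (g x)\<^sup>2) x) \<partial>M)"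
      by (rule nn_integral_eq_integral[OF I', symmetric]) (use one in eventually_elim, auto)
    also have "\<dots> = (\<integral>\<^sup>+x\<in>A. 1 \<partial>M)"
      by (intro nn_integral_cong_AE) (use one in eventually_elim, auto split: split_indicator)
    finally show "(\<integral>\<^sup>+x\<in>A. ennreal ((g x)\<^sup>2) \<partial>M) = (\<integral>\<^sup>+x\<in>A. 1 \<partial>M)" .
  qed auto
  then have "(\<integral>\<^sup>+x. ennreal ((f x)\<^sup>2) \<partial>M)
      = (\<integral>\<^sup>+x. ennreal ((f x)\<^sup>2) * nn_cond_exp M F (\<lambda>x. ennreal ((g x)\<^sup>2)) x \<partial>M)"
    by (intro nn_integral_cong_AE, eventually_elim) (metis mult.right_neutral)
  also have "\<dots> = (\<integral>\<^sup>+x. ennreal ((f x)\<^sup>2) * ennreal ((g x)\<^sup>2) \<partial>M)"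
    by (rule nn_cond_exp_intg) auto
  also have "\<dots> = (\<integral>\<^sup>+x. ennreal ((f x * g x)\<^sup>2) \<partial>M)"
    by (simp add: ennreal_mult[symmetric] power_mult_distrib)
  finally have "(\<integral>\<^sup>+x. ennreal ((f x * g x)\<^sup>2) \<partial>M) = (\<integral>\<^sup>+x. ennreal ((f x)\<^sup>2) \<partial>M)" ..
  then show ?thesis
    using f(2) by (simp add: integrable_iff_bounded)
qed

text \<open>
  The truncation of \<open>h\<close> makes \<open>(f - \<phi> g)\<^sup>2\<close> integrable before it is
  known that \<open>h\<^sup>2\<close> is.
\<close>

lemma (in sigma_finite_subalgebra) integrable_square_cond_exp_mult:
  fixes f g :: "'a \<Rightarrow> real"
  assumes f: "f \<in> borel_measurable M" "integrable M (\<lambda>x. (f x)\<^sup>2)"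
    and g: "g \<in> borel_measurable M" "integrable M (\<lambda>x. (g x)\<^sup>2)"
    and one: "AE x in M. real_cond_exp M F (\<lambda>x. (g x)\<^sup>2) x = 1"
  shows "integrable M (\<lambda>x. (real_cond_exp M F (\<lambda>x. g x * f x) x)\<^sup>2)"
proof -
  note [measurable] = f(1) g(1)
  define h where "h = real_cond_exp M F (\<lambda>x. g x * f x)"
  have [measurable]: "h \<in> borel_measurable F" "h \<in> borel_measurable M" by (auto simp: h_def)
  define \<phi> where "\<phi> n x = (if \<bar>h x\<bar> \<le> real n then h x else 0)" for n x
  have \<phi>F [measurable]: "\<phi> n \<in> borel_measurable F" and \<phi>M [measurable]: "\<phi> n \<in> borel_measurable M" for n
    unfolding \<phi>_def by measurable
  have \<phi>b: "\<bar>\<phi> n x\<bar> \<le> real n" for n x unfolding \<phi>_def by auto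
  have gf: "integrable M (\<lambda>x. g x * f x)"
  proof (rule Bochner_Integration.integrable_bound)
    show "integrable M (\<lambda>x. (f x)\<^sup>2 + (g x)\<^sup>2)" using f g by simp
    show "AE x in M. norm (g x * f x) \<le> norm ((f x)\<^sup>2 + (g x)\<^sup>2)"
      using abs_mult_le_sum_squares[of "g _" "f _"] by (simp add: add.commute)
  qed simp
  \<comment> \<open>The conditional expectation of \<open>(f x - \<phi> n x * g x)\<^sup>2\<close>
    is nonnegative. Expanded, its last two terms are \<open>- 2 * \<phi> n x * h x\<close> and
    \<open>(\<phi> n x)\<^sup>2\<close>; since
    \<open>\<phi> n x * h x = (\<phi> n x)\<^sup>2\<close>, they add up to
    \<open>- (\<phi> n x)\<^sup>2\<close>.\<close>
  have "AE x in M. (\<phi> n x)\<^sup>2 \<le> real_cond_exp M F (\<lambda>x. (f x)\<^sup>2) x" for n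
  proof -
    have i1: "integrable M (\<lambda>x. (- 2 * \<phi> n x) * (g x * f x))"
    proof (rule Bochner_Integration.integrable_bound)
      show "integrable M (\<lambda>x. 2 * real n * \<bar>g x * f x\<bar>)"
        by (intro integrable_mult_right integrable_abs gf)
      have "\<bar>\<phi> n x\<bar> * \<bar>g x * f x\<bar> \<le> real n * \<bar>g x * f x\<bar>" for x
        using \<phi>b by (intro mult_right_mono) auto
      then show "AE x in M. norm ((- 2 * \<phi> n x) * (g x * f x)) \<le> norm (2 * real n * \<bar>g x * f x\<bar>)"
        by (simp add: abs_mult mult.assoc)
    qed simp
    have i2: "integrable M (\<lambda>x. (\<phi> n x)\<^sup>2 * (g x)\<^sup>2)"
      by (rule Bochner_Integration.integrable_bound[where f = "\<lambda>x. (real n)\<^sup>2 * (g x)\<^sup>2"])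
        (use g \<phi>b[of n] in \<open>auto simp: abs_mult abs_le_square_iff[symmetric] intro!: mult_right_mono AE_I2\<close>)
    have sq: "(\<lambda>x. (f x)\<^sup>2 + ((- 2 * \<phi> n x) * (g x * f x) + (\<phi> n x)\<^sup>2 * (g x)\<^sup>2)) = (\<lambda>x. (f x - \<phi> n x * g x)\<^sup>2)"
      by (rule ext) (simp add: power2_eq_square algebra_simps)
    have 1: "AE x in M. 0 \<le> real_cond_exp M F (\<lambda>x. (f x)\<^sup>2 + ((- 2 * \<phi> n x) * (g x * f x) + (\<phi> n x)\<^sup>2 * (g x)\<^sup>2)) x"
      unfolding sq by (rule real_cond_exp_pos) auto
    note 2 = real_cond_exp_add[OF f(2) Bochner_Integration.integrable_add[OF i1 i2]]
    note 3 = real_cond_exp_add[OF i1 i2]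
    have 4: "AE x in M. real_cond_exp M F (\<lambda>x. (- 2 * \<phi> n x) * (g x * f x)) x = (- 2 * \<phi> n x) * h x"
      unfolding h_def by (rule real_cond_exp_mult[OF _ _ i1]) auto
    have 5: "AE x in M. real_cond_exp M F (\<lambda>x. (\<phi> n x)\<^sup>2 * (g x)\<^sup>2) x
        = (\<phi> n x)\<^sup>2 * real_cond_exp M F (\<lambda>x. (g x)\<^sup>2) x"
      by (rule real_cond_exp_mult[OF _ _ i2]) auto
    have 6: "\<phi> n x * h x = (\<phi> n x)\<^sup>2" for x by (simp add: \<phi>_def power2_eq_square)
    from 1 2 3 4 5 one show ?thesis
    proof eventually_elim
      case (elim x)
      have "(\<phi> n x)\<^sup>2 * real_cond_exp M F (\<lambda>x. (g x)\<^sup>2) x = (\<phi> n x)\<^sup>2"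
        by (simp only: elim(6) mult_1_right)
      moreover have "(- 2 * \<phi> n x) * h x = - 2 * (\<phi> n x)\<^sup>2"
        by (simp only: mult.assoc 6)
      ultimately show ?case using elim(1-5) by linarith
    qed
  qed
  \<comment> \<open>One null set serves all \<open>n\<close>, so \<open>n\<close> may be chosen
    depending on the point, beyond \<open>\<bar>h x\<bar>\<close>, where the truncation is
    inactive.\<close>
  then have "AE x in M. \<forall>n. (\<phi> n x)\<^sup>2 \<le> real_cond_exp M F (\<lambda>x. (f x)\<^sup>2) x"
    by (simp add: AE_all_countable)
  then have le: "AE x in M. (h x)\<^sup>2 \<le> real_cond_exp M F (\<lambda>x. (f x)\<^sup>2) x"
  proof eventually_elim
    case (elim x)
    obtain n where "\<bar>h x\<bar> \<le> real n" using real_arch_simple by blast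
    then have "\<phi> n x = h x" by (simp add: \<phi>_def)
    then show ?case using elim by metis
  qed
  have "integrable M (\<lambda>x. (h x)\<^sup>2)"
    by (rule Bochner_Integration.integrable_bound[OF real_cond_exp_int(1)[OF f(2)]])
      (use le in \<open>auto elim!: eventually_mono\<close>)
  then show ?thesis unfolding h_def .
qed

section \<open>The noise filtration and the spaces \<open>L2 k\<close>\<close>

context lq_problem
begin

text \<open>The bound \<open>k \<le> N\<close> recurs throughout because only the noises before time
  \<open>N\<close> are assumed measurable.\<close>

lemma subalgebra_Filt: "k \<le> N \<Longrightarrow> subalgebra M (Filt k)"
  unfolding subalgebra_def noise_filtration_def
  by (auto intro!: sets.sigma_sets_subset simp: measurable_sets[OF noise_measurable] space_measure_of_conv sets_measure_of_conv)

lemma subalgebra_Filt_mono: "j \<le> k \<Longrightarrow> subalgebra (Filt k) (Filt j)"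
proof -
  assume "j \<le> k"
  then have "(\<Union>i<j. {w i -` S \<inter> space M | S. S \<in> sets borel}) \<subseteq> (\<Union>i<k. {w i -` S \<inter> space M | S. S \<in> sets borel})"
    by (intro UN_mono) auto
  moreover have "(\<Union>i<k. {w i -` S \<inter> space M | S. S \<in> sets borel}) \<subseteq> Pow (space M)" for k by auto
  ultimately show ?thesis
    unfolding subalgebra_def noise_filtration_def
    by (auto simp: space_measure_of_conv sets_measure_of_conv intro: sigma_sets_mono')
       (meson in_mono sigma_sets_mono')
qed

lemma sigma_finite_Filt: "k \<le> N \<Longrightarrow> sigma_finite_subalgebra M (Filt k)"
  by (intro finite_measure_subalgebra_is_sigma_finite finite_measure_subalgebra.intro
      finite_measure_subalgebra_axioms.intro subalgebra_Filt finite_measure_axioms)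

lemma noise_adapted: "w k \<in> borel_measurable (Filt (Suc k))"
proof (rule measurableI)
  fix S :: "real set" assume "S \<in> sets borel"
  then show "w k -` S \<inter> space (Filt (Suc k)) \<in> sets (Filt (Suc k))"
    unfolding noise_filtration_def
    by (subst sets_measure_of) (auto simp: space_measure_of_conv intro!: sigma_sets.Basic)
qed simp

lemma measurable_Filt: "k \<le> N \<Longrightarrow> X \<in> measurable (Filt k) A \<Longrightarrow> X \<in> measurable M A"
  by (rule measurable_from_subalg[OF subalgebra_Filt])

lemma measurable_Filt_mono: "j \<le> k \<Longrightarrow> X \<in> measurable (Filt j) A \<Longrightarrow> X \<in> measurable (Filt k) A"
  by (rule measurable_from_subalg[OF subalgebra_Filt_mono])

lemma EE1_tower:
  assumes "j \<le> k" "k \<le> N" "integrable M f"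
  shows "AE \<omega> in M. EE1 j (EE1 k f) \<omega> = EE1 j f \<omega>"
proof -
  interpret sigma_finite_subalgebra M "Filt j" using assms by (auto intro!: sigma_finite_Filt)
  show ?thesis
    by (rule real_cond_exp_nested_subalg[OF subalgebra_Filt[OF assms(2)] subalgebra_Filt_mono[OF assms(1)] assms(3)])
qed

text \<open>Barred terms condition the noise of time \<open>l\<close> on the earlier time
  \<open>k\<close>, so the variance condition imposed at time \<open>l\<close> has to be carried
  down by the tower property.\<close>

lemma noise_variance_tower:
  assumes "k \<le> l" "l < N"
  shows "AE \<omega> in M. EE1 k (\<lambda>\<omega>'. (w l \<omega>')\<^sup>2) \<omega> = 1"
proof -
  interpret sigma_finite_subalgebra M "Filt k" using assms by (auto intro!: sigma_finite_Filt)
  have "AE \<omega> in M. EE1 k (EE1 l (\<lambda>\<omega>'. (w l \<omega>')\<^sup>2)) \<omega> = EE1 k (\<lambda>\<omega>. 1) \<omega>"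
    by (rule real_cond_exp_cong[OF noise_variance]) (use assms in auto)
  moreover have "AE \<omega> in M. EE1 k (EE1 l (\<lambda>\<omega>'. (w l \<omega>')\<^sup>2)) \<omega> = EE1 k (\<lambda>\<omega>'. (w l \<omega>')\<^sup>2) \<omega>"
    using assms by (intro EE1_tower noise_square_integrable) auto
  moreover have "AE \<omega> in M. EE1 k (\<lambda>\<omega>. 1) \<omega> = 1"
    by (rule real_cond_exp_F_meas) auto
  ultimately show ?thesis by eventually_elim simp
qed

text \<open>Connects the norm in \<open>L2\<close> with the scalar estimates, which apply to
  components because \<open>vec_cond_exp\<close> is formed componentwise.\<close>

lemma L2_iff_components:
  fixes X :: "'a \<Rightarrow> real ^ 'd::finite"
  assumes "k \<le> N"
  shows "X \<in> L2 k \<longleftrightarrow>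
    (\<forall>i. (\<lambda>\<omega>. X \<omega> $ i) \<in> borel_measurable (Filt k) \<and> integrable M (\<lambda>\<omega>. (X \<omega> $ i)\<^sup>2))"
proof -
  have m: "X \<in> borel_measurable (Filt k) \<longleftrightarrow> (\<forall>i. (\<lambda>\<omega>. X \<omega> $ i) \<in> borel_measurable (Filt k))"
    by (subst borel_measurable_euclidean_space) (auto simp: Basis_vec_def inner_axis)
  have n: "(norm (X \<omega>))\<^sup>2 = (\<Sum>i\<in>UNIV. (X \<omega> $ i)\<^sup>2)" for \<omega>
    by (simp add: power2_norm_eq_inner inner_vec_def) (simp add: power2_eq_square)
  have "integrable M (\<lambda>\<omega>. (X \<omega> $ i)\<^sup>2)"
    if "X \<in> borel_measurable (Filt k)" "integrable M (\<lambda>\<omega>. (norm (X \<omega>))\<^sup>2)" for i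
  proof (rule Bochner_Integration.integrable_bound[OF that(2)])
    show "(\<lambda>\<omega>. (X \<omega> $ i)\<^sup>2) \<in> borel_measurable M"
      using that(1) m measurable_Filt[OF \<open>k \<le> N\<close>] by (intro borel_measurable_power) blast
    show "AE \<omega> in M. norm ((X \<omega> $ i)\<^sup>2) \<le> norm ((norm (X \<omega>))\<^sup>2)"
      by (auto intro!: AE_I2 power_mono component_le_norm_cart simp: abs_le_square_iff[symmetric])
  qed
  moreover have "integrable M (\<lambda>\<omega>. (norm (X \<omega>))\<^sup>2)" if "\<forall>i. integrable M (\<lambda>\<omega>. (X \<omega> $ i)\<^sup>2)"
    unfolding n using that by simp
  ultimately show ?thesis unfolding L2_def using m by blast
qed

lemma L2_measurable: "X \<in> L2 k \<Longrightarrow> X \<in> borel_measurable (Filt k)"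
  by (simp add: L2_def)

lemma L2_measurable_M: "X \<in> L2 k \<Longrightarrow> k \<le> N \<Longrightarrow> X \<in> borel_measurable M"
  using measurable_Filt L2_measurable by blast

lemma measurable_component:
  "X \<in> borel_measurable A \<Longrightarrow> (\<lambda>\<omega>. (X \<omega> :: real ^ 'd::finite) $ i) \<in> borel_measurable A"
  using measurable_compose[of X A borel "\<lambda>x. x $ i" borel]
  by (simp add: borel_measurable_continuous_onI continuous_on_component)

lemma L2_component:
  assumes "X \<in> L2 k" "k \<le> N"
  shows "(\<lambda>\<omega>. X \<omega> $ i) \<in> borel_measurable (Filt k)" "(\<lambda>\<omega>. X \<omega> $ i) \<in> borel_measurable M"
    "integrable M (\<lambda>\<omega>. (X \<omega> $ i)\<^sup>2)"
  using assms measurable_Filt by (auto simp: L2_iff_components)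

lemma L2_mono:
  assumes "X \<in> L2 j" "j \<le> k"
  shows "X \<in> L2 k"
  using assms measurable_Filt_mono unfolding L2_def by blast

lemma L2_add:
  assumes X: "X \<in> L2 k" and Y: "Y \<in> L2 k" and k: "k \<le> N"
  shows "(\<lambda>\<omega>. X \<omega> + Y \<omega>) \<in> L2 k"
proof -
  note [measurable] = L2_measurable[OF X] L2_measurable[OF Y] L2_measurable_M[OF X k] L2_measurable_M[OF Y k]
  have "integrable M (\<lambda>\<omega>. (norm (X \<omega> + Y \<omega>))\<^sup>2)"
  proof (rule Bochner_Integration.integrable_bound)
    show "integrable M (\<lambda>\<omega>. 2 * (norm (X \<omega>))\<^sup>2 + 2 * (norm (Y \<omega>))\<^sup>2)"
      using X Y by (simp add: L2_def)
    have "(norm (X \<omega> + Y \<omega>))\<^sup>2 \<le> 2 * (norm (X \<omega>))\<^sup>2 + 2 * (norm (Y \<omega>))\<^sup>2" for \<omega>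
    proof -
      have "(norm (X \<omega> + Y \<omega>))\<^sup>2 + (norm (X \<omega> - Y \<omega>))\<^sup>2 = 2 * (norm (X \<omega>))\<^sup>2 + 2 * (norm (Y \<omega>))\<^sup>2"
        by (simp add: power2_norm_eq_inner inner_add inner_diff)
      then show ?thesis using zero_le_power2[of "norm (X \<omega> - Y \<omega>)"] by linarith
    qed
    then show "AE \<omega> in M. norm ((norm (X \<omega> + Y \<omega>))\<^sup>2) \<le> norm (2 * (norm (X \<omega>))\<^sup>2 + 2 * (norm (Y \<omega>))\<^sup>2)"
      by simp
  qed measurable
  then show ?thesis unfolding L2_def by simp
qed

lemma L2_bounded_linear:
  assumes T: "bounded_linear T" and X: "X \<in> L2 k" and k: "k \<le> N"
  shows "(\<lambda>\<omega>. T (X \<omega>)) \<in> L2 k"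
proof -
  have [measurable]: "T \<in> borel_measurable borel"
    using T by (intro borel_measurable_continuous_onI bounded_linear.continuous_on[OF T] continuous_on_id)
  note [measurable] = L2_measurable[OF X] L2_measurable_M[OF X k]
  obtain K where K: "\<And>x. norm (T x) \<le> norm x * K" using bounded_linear.bounded[OF T] by blast
  have "integrable M (\<lambda>\<omega>. (norm (T (X \<omega>)))\<^sup>2)"
  proof (rule Bochner_Integration.integrable_bound)
    show "integrable M (\<lambda>\<omega>. (norm (X \<omega>))\<^sup>2 * K\<^sup>2)" using X by (simp add: L2_def)
    have "(norm (T (X \<omega>)))\<^sup>2 \<le> (norm (X \<omega>))\<^sup>2 * K\<^sup>2" for \<omega>
      unfolding power_mult_distrib[symmetric] by (rule power_mono[OF K]) simp
    then show "AE \<omega> in M. norm ((norm (T (X \<omega>)))\<^sup>2) \<le> norm ((norm (X \<omega>))\<^sup>2 * K\<^sup>2)" by simp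
  qed measurable
  then show ?thesis unfolding L2_def by simp
qed

lemma L2_matrix: "X \<in> L2 k \<Longrightarrow> k \<le> N \<Longrightarrow> (\<lambda>\<omega>. A *v X \<omega>) \<in> L2 k"
  by (rule L2_bounded_linear[OF matrix_vector_mul_bounded_linear])

lemma L2_scaleR: "X \<in> L2 k \<Longrightarrow> k \<le> N \<Longrightarrow> (\<lambda>\<omega>. c *\<^sub>R X \<omega>) \<in> L2 k"
  by (rule L2_bounded_linear[OF bounded_linear_scaleR_right])

lemma L2_diff: "X \<in> L2 k \<Longrightarrow> Y \<in> L2 k \<Longrightarrow> k \<le> N \<Longrightarrow> (\<lambda>\<omega>. X \<omega> - Y \<omega>) \<in> L2 k"
  using L2_add[OF _ L2_scaleR[of Y k "-1"]] by simp

lemma L2_const: "(\<lambda>\<omega>. c) \<in> L2 k"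
  by (simp add: L2_def)

text \<open>Conditional Cauchy-Schwarz against a noise of conditional variance one. The product
  under the expectation need not be square integrable itself.\<close>

lemma L2_EE_noise:
  assumes "Z \<in> L2 j" "j \<le> N" "k \<le> l" "l < N"
  shows "EE k (\<lambda>\<omega>. w l \<omega> *\<^sub>R Z \<omega>) \<in> L2 k"
proof -
  interpret sigma_finite_subalgebra M "Filt k" using assms by (auto intro!: sigma_finite_Filt)
  show ?thesis
    using assms L2_component[OF assms(1,2)] noise_variance_tower[OF assms(3,4)]
    by (auto simp: L2_iff_components vec_cond_exp_def noise_measurable noise_square_integrable
        intro!: integrable_square_cond_exp_mult)
qed

text \<open>The same estimate with the constant 1 in place of the noise, which is Jensen's
  inequality for the square.\<close>

lemma L2_EE:
  assumes "Z \<in> L2 j" "j \<le> N" "k \<le> N"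
  shows "EE k Z \<in> L2 k"
proof -
  interpret sigma_finite_subalgebra M "Filt k" using assms by (auto intro!: sigma_finite_Filt)
  have "AE \<omega> in M. EE1 k (\<lambda>\<omega>. 1\<^sup>2) \<omega> = 1"
    unfolding one_power2 by (rule real_cond_exp_F_meas) auto
  then show ?thesis
    using assms L2_component[OF assms(1,2)] integrable_square_cond_exp_mult[of _ "\<lambda>\<omega>. 1"]
    by (auto simp: L2_iff_components vec_cond_exp_def)
qed

text \<open>\<open>X\<close> is known before \<open>w k\<close>, so its components keep their second
  moments. The time index rises by one because \<open>w k\<close> is revealed only in
  \<open>Filt (Suc k)\<close>.\<close>

lemma L2_noise:
  assumes "X \<in> L2 k" "k < N"
  shows "(\<lambda>\<omega>. w k \<omega> *\<^sub>R X \<omega>) \<in> L2 (Suc k)"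
proof -
  interpret sigma_finite_subalgebra M "Filt k" using assms by (auto intro!: sigma_finite_Filt)
  have k: "k \<le> N" "Suc k \<le> N" using assms by auto
  have "integrable M (\<lambda>\<omega>. (X \<omega> $ i * w k \<omega>)\<^sup>2)" for i
    using L2_component[OF assms(1) k(1)] assms noise_variance_tower[of k k]
    by (intro integrable_mult_square) (auto simp: noise_measurable noise_square_integrable)
  moreover have "(\<lambda>\<omega>. w k \<omega> * X \<omega> $ i) \<in> borel_measurable (Filt (Suc k))" for i
    using noise_adapted[of k] measurable_Filt_mono[OF _ L2_component(1)[OF assms(1) k(1)]]
    by (intro borel_measurable_times) auto
  ultimately show ?thesis
    using k by (simp add: L2_iff_components mult.commute)
qed

lemma integrable_component_mult:
  assumes "X \<in> L2 j" "Y \<in> L2 k" "j \<le> N" "k \<le> N"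
  shows "integrable M (\<lambda>\<omega>. X \<omega> $ a * Y \<omega> $ b)"
proof (rule Bochner_Integration.integrable_bound)
  note X = L2_component[OF assms(1,3)] and Y = L2_component[OF assms(2,4)]
  show "integrable M (\<lambda>\<omega>. (X \<omega> $ a)\<^sup>2 + (Y \<omega> $ b)\<^sup>2)" using X Y by simp
  show "AE \<omega> in M. norm (X \<omega> $ a * Y \<omega> $ b) \<le> norm ((X \<omega> $ a)\<^sup>2 + (Y \<omega> $ b)\<^sup>2)"
    using abs_mult_le_sum_squares by simp
  show "(\<lambda>\<omega>. X \<omega> $ a * Y \<omega> $ b) \<in> borel_measurable M" using X Y by simp
qed

lemma integrable_inner:
  assumes "X \<in> L2 j" "Y \<in> L2 k" "j \<le> N" "k \<le> N"
  shows "integrable M (\<lambda>\<omega>. X \<omega> \<bullet> Y \<omega>)"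
  using integrable_component_mult[OF assms] by (simp add: inner_vec_def)

lemma integrable_component:
  assumes "X \<in> L2 j" "j \<le> N"
  shows "integrable M (\<lambda>\<omega>. X \<omega> $ i)"
  using integrable_component_mult[OF assms(1) L2_const[of "\<chi> i. 1" 0] assms(2)] by simp

lemma EE_cong:
  assumes "AE \<omega> in M. X \<omega> = Y \<omega>" "X \<in> borel_measurable M" "Y \<in> borel_measurable M" "k \<le> N"
  shows "AE \<omega> in M. EE k X \<omega> = EE k Y \<omega>"
proof -
  interpret sigma_finite_subalgebra M "Filt k" using assms by (auto intro!: sigma_finite_Filt)
  have "AE \<omega> in M. EE1 k (\<lambda>\<omega>. X \<omega> $ i) \<omega> = EE1 k (\<lambda>\<omega>. Y \<omega> $ i) \<omega>" for i
    by (rule real_cond_exp_cong) (use assms in \<open>auto elim: eventually_mono intro: measurable_component\<close>)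
  then have "AE \<omega> in M. \<forall>i. EE1 k (\<lambda>\<omega>. X \<omega> $ i) \<omega> = EE1 k (\<lambda>\<omega>. Y \<omega> $ i) \<omega>"
    by (simp add: AE_finite_all AE_all_countable)
  then show ?thesis by (simp add: vec_cond_exp_def vec_eq_iff)
qed

lemma EE_adapted:
  assumes "X \<in> L2 k" "k \<le> N"
  shows "AE \<omega> in M. EE k X \<omega> = X \<omega>"
proof -
  interpret sigma_finite_subalgebra M "Filt k" using assms by (auto intro!: sigma_finite_Filt)
  have "AE \<omega> in M. EE1 k (\<lambda>\<omega>. X \<omega> $ i) \<omega> = X \<omega> $ i" for i
    by (rule real_cond_exp_F_meas) (use assms integrable_component L2_component in auto)
  then have "AE \<omega> in M. \<forall>i. EE1 k (\<lambda>\<omega>. X \<omega> $ i) \<omega> = X \<omega> $ i"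
    by (simp add: AE_all_countable)
  then show ?thesis by (simp add: vec_cond_exp_def vec_eq_iff)
qed

lemma EE_add_scaleR:
  assumes "X \<in> L2 j" "Y \<in> L2 j" "j \<le> N" "k \<le> N"
  shows "AE \<omega> in M. EE k (\<lambda>\<omega>. X \<omega> + c *\<^sub>R Y \<omega>) \<omega> = EE k X \<omega> + c *\<^sub>R EE k Y \<omega>"
proof -
  interpret sigma_finite_subalgebra M "Filt k" using assms by (auto intro!: sigma_finite_Filt)
  note i = integrable_component[OF assms(1,3)] integrable_component[OF assms(2,3)]
  have "AE \<omega> in M. EE1 k (\<lambda>\<omega>. X \<omega> $ a + c * Y \<omega> $ a) \<omega>
      = EE1 k (\<lambda>\<omega>. X \<omega> $ a) \<omega> + c * EE1 k (\<lambda>\<omega>. Y \<omega> $ a) \<omega>" for a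
    using real_cond_exp_add[OF i(1)[of a] integrable_mult_right[OF i(2)[of a], of c]]
      real_cond_exp_cmult[OF i(2)[of a], of c]
    by eventually_elim auto
  then have "AE \<omega> in M. \<forall>a. EE1 k (\<lambda>\<omega>. X \<omega> $ a + c * Y \<omega> $ a) \<omega>
      = EE1 k (\<lambda>\<omega>. X \<omega> $ a) \<omega> + c * EE1 k (\<lambda>\<omega>. Y \<omega> $ a) \<omega>"
    by (simp add: AE_all_countable)
  then show ?thesis by (simp add: vec_cond_exp_def vec_eq_iff)
qed

section \<open>Calculus of equal conditional expectations\<close>

text \<open>Integrability is built in because the rules for \<open>real_cond_exp\<close> require it.
  Chains of such relations then compose by transitivity, and may replace an integrand by one that is
  not almost surely equal to it.\<close>

definition ceq :: "nat \<Rightarrow> ('a \<Rightarrow> real) \<Rightarrow> ('a \<Rightarrow> real) \<Rightarrow> bool" where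
  "ceq k f g \<longleftrightarrow> integrable M f \<and> integrable M g \<and> (AE \<omega> in M. EE1 k f \<omega> = EE1 k g \<omega>)"

lemma ceq_AE:
  assumes "AE \<omega> in M. f \<omega> = g \<omega>" "integrable M f" "integrable M g" "k \<le> N"
  shows "ceq k f g"
proof -
  interpret sigma_finite_subalgebra M "Filt k" using assms by (auto intro!: sigma_finite_Filt)
  show ?thesis unfolding ceq_def using real_cond_exp_cong[OF assms(1)] assms(2,3) by auto
qed

lemma ceq_trans [trans]: "ceq k f g \<Longrightarrow> ceq k g h \<Longrightarrow> ceq k f h"
  unfolding ceq_def by (auto elim: eventually_elim2)

lemma ceq_sym: "ceq k f g \<Longrightarrow> ceq k g f"
  unfolding ceq_def by (auto elim: eventually_mono)

lemma ceq_add: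
  assumes "ceq k f g" "ceq k f' g'" "k \<le> N"
  shows "ceq k (\<lambda>\<omega>. f \<omega> + f' \<omega>) (\<lambda>\<omega>. g \<omega> + g' \<omega>)"
proof -
  interpret sigma_finite_subalgebra M "Filt k" using assms by (auto intro!: sigma_finite_Filt)
  have i: "integrable M f" "integrable M f'" "integrable M g" "integrable M g'"
    and e: "AE \<omega> in M. EE1 k f \<omega> = EE1 k g \<omega>" "AE \<omega> in M. EE1 k f' \<omega> = EE1 k g' \<omega>"
    using assms by (auto simp: ceq_def)
  from real_cond_exp_add[OF i(1,2)] real_cond_exp_add[OF i(3,4)] e
  have "AE \<omega> in M. EE1 k (\<lambda>\<omega>. f \<omega> + f' \<omega>) \<omega> = EE1 k (\<lambda>\<omega>. g \<omega> + g' \<omega>) \<omega>"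
    by eventually_elim simp
  then show ?thesis using i by (simp add: ceq_def)
qed

lemma ceq_cmult:
  assumes "ceq k f g" "k \<le> N"
  shows "ceq k (\<lambda>\<omega>. c * f \<omega>) (\<lambda>\<omega>. c * g \<omega>)"
proof -
  interpret sigma_finite_subalgebra M "Filt k" using assms by (auto intro!: sigma_finite_Filt)
  have i: "integrable M f" "integrable M g"
    and e: "AE \<omega> in M. EE1 k f \<omega> = EE1 k g \<omega>"
    using assms by (auto simp: ceq_def)
  from real_cond_exp_cmult[OF i(1), of c] real_cond_exp_cmult[OF i(2), of c] e
  have "AE \<omega> in M. EE1 k (\<lambda>\<omega>. c * f \<omega>) \<omega> = EE1 k (\<lambda>\<omega>. c * g \<omega>) \<omega>"
    by eventually_elim simp
  then show ?thesis using i by (simp add: ceq_def)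
qed

lemma ceq_sum:
  assumes "\<And>i. i \<in> I \<Longrightarrow> ceq k (f i) (g i)" "k \<le> N" "finite I"
  shows "ceq k (\<lambda>\<omega>. \<Sum>i\<in>I. f i \<omega>) (\<lambda>\<omega>. \<Sum>i\<in>I. g i \<omega>)"
  using assms(3,1)
proof (induction I)
  case empty
  then show ?case using assms by (intro ceq_AE) auto
next
  case (insert i I)
  then show ?case using ceq_add[of k "f i" "g i"] assms(2) by simp
qed

text \<open>\<open>X\<close> is known at time \<open>l\<close> and can be pulled out of the
  expectation at \<open>l\<close>; the tower property then descends to \<open>k\<close>. Only the
  products of components are required to be integrable, so that \<open>Z\<close> may carry a noise
  factor and lie outside \<open>L2\<close>.\<close>

lemma ceq_inner_EE_measurable:
  assumes "k \<le> l" "l \<le> N" "X \<in> borel_measurable (Filt l)" "Z \<in> borel_measurable M"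
    and i: "\<And>i. integrable M (\<lambda>\<omega>. X \<omega> $ i * Z \<omega> $ i)"
  shows "ceq k (\<lambda>\<omega>. X \<omega> \<bullet> Z \<omega>) (\<lambda>\<omega>. X \<omega> \<bullet> EE l Z \<omega>)"
proof -
  interpret k: sigma_finite_subalgebra M "Filt k" using assms by (auto intro!: sigma_finite_Filt)
  interpret l: sigma_finite_subalgebra M "Filt l" using assms by (auto intro!: sigma_finite_Filt)
  have "ceq k (\<lambda>\<omega>. X \<omega> $ i * Z \<omega> $ i) (\<lambda>\<omega>. X \<omega> $ i * EE1 l (\<lambda>\<omega>. Z \<omega> $ i) \<omega>)" for i
  proof -
    note m = measurable_component[OF assms(3), of i] measurable_component[OF assms(4), of i]
    have I: "integrable M (\<lambda>\<omega>. X \<omega> $ i * EE1 l (\<lambda>\<omega>. Z \<omega> $ i) \<omega>)"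
      by (rule l.real_cond_exp_intg(1)[OF i m])
    have 1: "AE \<omega> in M. EE1 k (EE1 l (\<lambda>\<omega>. X \<omega> $ i * Z \<omega> $ i)) \<omega>
        = EE1 k (\<lambda>\<omega>. X \<omega> $ i * EE1 l (\<lambda>\<omega>. Z \<omega> $ i) \<omega>) \<omega>"
      using I by (intro k.real_cond_exp_cong l.real_cond_exp_mult[OF m i]) auto
    from EE1_tower[OF assms(1,2) i[of i]] 1
    have "AE \<omega> in M. EE1 k (\<lambda>\<omega>. X \<omega> $ i * Z \<omega> $ i) \<omega>
        = EE1 k (\<lambda>\<omega>. X \<omega> $ i * EE1 l (\<lambda>\<omega>. Z \<omega> $ i) \<omega>) \<omega>"
      by eventually_elim simp
    then show ?thesis using i I by (simp add: ceq_def)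
  qed
  then show ?thesis
    using assms by (auto simp: inner_vec_def vec_cond_exp_def intro!: ceq_sum)
qed

lemma ceq_inner_EE:
  assumes "k \<le> l" "l \<le> N" "X \<in> L2 l" "Z \<in> L2 j" "j \<le> N"
  shows "ceq k (\<lambda>\<omega>. X \<omega> \<bullet> Z \<omega>) (\<lambda>\<omega>. X \<omega> \<bullet> EE l Z \<omega>)"
  using assms by (intro ceq_inner_EE_measurable L2_measurable L2_measurable_M integrable_component_mult)

text \<open>For integrability the noise is moved to the other factor: \<open>w l *\<^sub>R X\<close>
  is in \<open>L2 (Suc l)\<close> because \<open>X\<close> is known at time
  \<open>l\<close>.\<close>

lemma ceq_inner_EE_noise:
  assumes "k \<le> l" "l < N" "X \<in> L2 l" "Z \<in> L2 j" "j \<le> N"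
  shows "ceq k (\<lambda>\<omega>. X \<omega> \<bullet> (w l \<omega> *\<^sub>R Z \<omega>)) (\<lambda>\<omega>. X \<omega> \<bullet> EE l (\<lambda>\<omega>. w l \<omega> *\<^sub>R Z \<omega>) \<omega>)"
proof (rule ceq_inner_EE_measurable)
  show "(\<lambda>\<omega>. w l \<omega> *\<^sub>R Z \<omega>) \<in> borel_measurable M"
    using assms L2_measurable_M noise_measurable by (intro borel_measurable_scaleR) auto
  show "integrable M (\<lambda>\<omega>. X \<omega> $ i * (w l \<omega> *\<^sub>R Z \<omega>) $ i)" for i
    using integrable_component_mult[OF L2_noise[OF assms(3,2)] assms(4), of i i] assms
    by (simp add: mult_ac)
qed (use assms L2_measurable in auto)

text \<open>Allows the outer conditional expectations in the costs to be dropped and their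
  integrands to be used instead.\<close>

lemma ceq_EE1: "integrable M f \<Longrightarrow> k \<le> N \<Longrightarrow> ceq k (EE1 k f) f"
  using EE1_tower[of k k f] sigma_finite_subalgebra.real_cond_exp_int(1)[OF sigma_finite_Filt]
  by (simp add: ceq_def)

text \<open>The way back from \<open>ceq\<close> to almost sure equality: a random variable known at
  time \<open>k\<close> is its own conditional expectation.\<close>

lemma AE_eq_if_ceq:
  assumes "ceq k f g" "f \<in> borel_measurable (Filt k)" "g \<in> borel_measurable (Filt k)" "k \<le> N"
  shows "AE \<omega> in M. f \<omega> = g \<omega>"
proof -
  interpret sigma_finite_subalgebra M "Filt k" using assms by (auto intro!: sigma_finite_Filt)
  have "AE \<omega> in M. EE1 k f \<omega> = f \<omega>" "AE \<omega> in M. EE1 k g \<omega> = g \<omega>"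
    "AE \<omega> in M. EE1 k f \<omega> = EE1 k g \<omega>"
    using assms real_cond_exp_F_meas unfolding ceq_def by auto
  then show ?thesis by eventually_elim simp
qed

section \<open>Controlled states and their response to a perturbation\<close>

lemma L2_EE_mono: "X \<in> L2 j \<Longrightarrow> j \<le> N \<Longrightarrow> k \<le> l \<Longrightarrow> l \<le> N \<Longrightarrow> EE k X \<in> L2 l"
  by (rule L2_mono, rule L2_EE) auto

lemma L2_EE_noise_mono:
  "Z \<in> L2 j \<Longrightarrow> j \<le> N \<Longrightarrow> k \<le> i \<Longrightarrow> i \<le> l \<Longrightarrow> l < N \<Longrightarrow> EE k (\<lambda>\<omega>. w l \<omega> *\<^sub>R Z \<omega>) \<in> L2 i"
  by (rule L2_mono, rule L2_EE_noise) auto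

lemma L2_affine_noise:
  assumes "a \<in> L2 l" "b \<in> L2 l" "l < N"
  shows "(\<lambda>\<omega>. a \<omega> + w l \<omega> *\<^sub>R b \<omega>) \<in> L2 (Suc l)"
  using L2_add[OF L2_mono[OF assms(1)] L2_noise[OF assms(2,3)]] assms(3) by simp

lemma state_initial [simp]: "state k \<xi> u k = \<xi>"
  by (cases k) auto

lemma state_Suc: "k \<le> l \<Longrightarrow> state k \<xi> u (Suc l) = state_step k l (state k \<xi> u l) (u l)"
  by simp

lemma L2_state_step:
  assumes "x \<in> L2 l" "v \<in> L2 l" "k \<le> l" "l < N"
  shows "state_step k l x v \<in> L2 (Suc l)"
  unfolding state_step_def using assms
  by (intro L2_affine_noise L2_add L2_matrix L2_const L2_EE_mono[where j = l]) auto

lemma L2_state: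
  assumes "\<xi> \<in> L2 k" "u \<in> L2_proc {k..<N}" "k \<le> l" "l \<le> N"
  shows "state k \<xi> u l \<in> L2 l"
  using assms(3,4)
proof (induction l rule: dec_induct)
  case base
  then show ?case using assms by simp
next
  case (step l)
  then have "u l \<in> L2 l" using assms(2) by (simp add: L2_proc_def)
  then show ?case using step state_Suc[of k l \<xi> u] by (simp add: L2_state_step del: state.simps)
qed

lemma pert_state_initial [simp]: "pert_state k v k = (\<lambda>\<omega>. 0)"
  by (cases k) auto

lemma pert_state_Suc:
  "k < l \<Longrightarrow> pert_state k v (Suc l) = (\<lambda>\<omega>.
        (cA P k l *v pert_state k v l \<omega> + cAb P k l *v EE k (pert_state k v l) \<omega>)
        + w l \<omega> *\<^sub>R
        (cC P k l *v pert_state k v l \<omega> + cCb P k l *v EE k (pert_state k v l) \<omega>))"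
  by simp

lemma L2_pert_state:
  assumes "v \<in> L2 k" "k \<le> l" "l \<le> N"
  shows "pert_state k v l \<in> L2 l"
  using assms(2,3)
proof (induction l rule: dec_induct)
  case base
  then show ?case by (simp add: L2_const)
next
  case (step l)
  note Y = step(3)[OF Suc_leD[OF step(4)]]
  from step(4) have lN: "l < N" by simp
  show ?case
  proof (cases "l = k")
    case True
    then show ?thesis using assms lN
      by (auto intro!: L2_affine_noise L2_matrix)
  next
    case False
    with step(1) have "k < l" by simp
    then show ?thesis using Y lN
      by (auto simp: pert_state_Suc simp del: pert_state.simps
          intro!: L2_affine_noise[of _ l] L2_add[of _ l] L2_matrix L2_EE_mono[where j = l])
  qed
qed

lemma L2_proc_update:
  assumes "u \<in> L2_proc {k..<N}" "v \<in> L2 k"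
  shows "u(k := v) \<in> L2_proc {k..<N}"
  using assms by (auto simp: L2_proc_def)

lemma matrix_vector_mult_add_scaleR:
  "A *v (x + c *\<^sub>R y) = A *v x + c *\<^sub>R (A *v y)" for A :: "real ^ 'd::finite ^ 'e::finite"
  by (simp add: matrix_vector_right_distrib matrix_vector_mult_scaleR)

text \<open>The state equation is affine, so its inhomogeneous terms cancel in the difference of the
  two states. At \<open>l = k\<close> the states agree, and \<open>EE k v = v\<close> merges each
  control coefficient with its barred partner; at later times the controls agree.\<close>

lemma state_perturbed:
  fixes v :: "'a \<Rightarrow> real ^ 'm" and c :: real
  assumes \<xi>: "\<xi> \<in> L2 k" and u: "u \<in> L2_proc {k..<N}" and v: "v \<in> L2 k"
    and kl: "k \<le> l" "l \<le> N"
  defines "u' \<equiv> u(k := \<lambda>\<omega>. u k \<omega> + c *\<^sub>R v \<omega>)"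
  shows "AE \<omega> in M. state k \<xi> u' l \<omega> = state k \<xi> u l \<omega> + c *\<^sub>R pert_state k v l \<omega>"
  using kl
proof (induction l rule: dec_induct)
  case base
  then show ?case by simp
next
  case (step l)
  let ?X' = "state k \<xi> u' l" and ?X = "state k \<xi> u l" and ?Y = "pert_state k v l"
  from step have lN: "l < N" "l \<le> N" "k \<le> N" and IH: "AE \<omega> in M. ?X' \<omega> = ?X \<omega> + c *\<^sub>R ?Y \<omega>" by auto
  have uk: "u k \<in> L2 k" using u lN step(1) by (auto simp: L2_proc_def)
  have u': "u' \<in> L2_proc {k..<N}"
    unfolding u'_def using u uk v lN by (intro L2_proc_update L2_add L2_scaleR) auto
  note X = L2_state[OF \<xi> u step(1) lN(2)] and X' = L2_state[OF \<xi> u' step(1) lN(2)]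
    and Y = L2_pert_state[OF v step(1) lN(2)]
  have E1: "AE \<omega> in M. EE k ?X' \<omega> = EE k (\<lambda>\<omega>. ?X \<omega> + c *\<^sub>R ?Y \<omega>) \<omega>"
    using X X' Y lN by (intro EE_cong[OF IH] L2_measurable_M[where k = l] L2_add L2_scaleR)
  note E2 = EE_add_scaleR[OF X Y lN(2,3), of c]
  show ?case
  proof (cases "l = k")
    case True
    from EE_add_scaleR[OF uk v lN(3,3), of c] EE_adapted[OF v lN(3)] show ?thesis
      by eventually_elim
        (use True in \<open>simp add: state_step_def u'_def matrix_vector_mult_add_scaleR
          matrix_vector_mult_add_rdistrib algebra_simps\<close>)
  next
    case False
    then have "u' l = u l" "k < l" using step(1) by (auto simp: u'_def)
    from E1 E2 IH show ?thesis
      unfolding state_Suc[OF step(1)] pert_state_Suc[OF \<open>k < l\<close>] state_step_def \<open>u' l = u l\<close>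
      by eventually_elim (simp add: matrix_vector_mult_add_scaleR algebra_simps)
  qed
qed

lemma inner_matrix_left: "(A *v x) \<bullet> y = x \<bullet> (transpose A *v y)" for A :: "real ^ 'd::finite ^ 'e::finite"
  by (metis dot_lmul_matrix transpose_matrix_vector inner_commute)

lemma inner_transpose: "(transpose A *v x) \<bullet> y = (A *v y) \<bullet> x" for A :: "real ^ 'd::finite ^ 'e::finite"
  by (metis inner_matrix_left inner_commute)

text \<open>Symmetry is what merges the two cross terms into one.\<close>

lemma quad_add_scaleR:
  assumes "transpose S = S"
  shows "quad S (x + c *\<^sub>R y) = quad S x + (2 * c) * ((S *v x) \<bullet> y) + c\<^sup>2 * quad S y"
proof -
  have "x \<bullet> (S *v y) = (S *v x) \<bullet> y" using inner_matrix_left[of S x y] assms by simp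
  then show ?thesis
    by (simp add: quad_def matrix_vector_mult_add_scaleR inner_add inner_commute algebra_simps power2_eq_square)
qed

lemma integrable_quad: "X \<in> L2 k \<Longrightarrow> k \<le> N \<Longrightarrow> integrable M (\<lambda>\<omega>. quad S (X \<omega>))"
  unfolding quad_def by (intro integrable_inner[where j = k and k = k] L2_matrix)

lemma integrable_inner_const: "X \<in> L2 k \<Longrightarrow> k \<le> N \<Longrightarrow> integrable M (\<lambda>\<omega>. a \<bullet> X \<omega>)"
  by (rule integrable_inner[OF L2_const]) auto

lemma measurable_quad: "X \<in> L2 k \<Longrightarrow> k \<le> N \<Longrightarrow> (\<lambda>\<omega>. quad S (X \<omega>)) \<in> borel_measurable (Filt k)"
  unfolding quad_def by (intro borel_measurable_inner L2_measurable L2_matrix)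

section \<open>Solutions of the forward-backward equation\<close>

text \<open>The costs are defined through the recursion \<open>state\<close>, whereas the forward
  component of a solution is determined only up to null sets. Since \<open>EE k\<close> respects
  almost sure equality, the two can be exchanged with \<open>Z\<close> unchanged.\<close>

lemma fbsde_solution_state:
  assumes sol: "fbsde_solution k \<xi> u X Z" and \<xi>: "\<xi> \<in> L2 k" and u: "u \<in> L2_proc {k..<N}" and k: "k < N"
  shows "fbsde_solution k \<xi> u (state k \<xi> u) Z"
proof -
  have X: "X l \<in> L2 l" if "l \<in> {k..N}" for l
    using sol that by (auto simp: fbsde_solution_def L2_proc_def)
  have S: "state k \<xi> u l \<in> L2 l" if "l \<in> {k..N}" for l
    using L2_state[OF \<xi> u] that by auto
  have step: "AE \<omega> in M. X (Suc l) \<omega> = state_step k l (X l) (u l) \<omega>" if "l \<in> {k..<N}" for l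
    using sol that by (auto simp: fbsde_solution_def)
  have EEeq: "AE \<omega> in M. EE k (X l) \<omega> = EE k (state k \<xi> u l) \<omega>"
    if "AE \<omega> in M. X l \<omega> = state k \<xi> u l \<omega>" "l \<in> {k..N}" for l
    using that k X[of l] S[of l] by (intro EE_cong L2_measurable_M[where k = l]) auto
  have eq: "AE \<omega> in M. X l \<omega> = state k \<xi> u l \<omega>" if "k \<le> l" "l \<le> N" for l
    using that
  proof (induction l rule: dec_induct)
    case base
    then show ?case using sol by (simp add: fbsde_solution_def)
  next
    case (step l)
    then have IH: "AE \<omega> in M. X l \<omega> = state k \<xi> u l \<omega>" and l: "l \<in> {k..<N}" "l \<in> {k..N}" by auto
    \<comment> \<open>The implication cited by its shape is the forward equation of \<open>X\<close>
      at time \<open>l\<close>.\<close>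
    from IH EEeq[OF IH l(2)] \<open>l \<in> {k..<N} \<Longrightarrow> _\<close>[OF l(1)] show ?case
      by eventually_elim (use l in \<open>simp add: state_step_def\<close>)
  qed
  show ?thesis
    unfolding fbsde_solution_def
  proof (intro conjI ballI)
    show "state k \<xi> u \<in> L2_proc {k..N}" using S by (simp add: L2_proc_def)
    show "Z \<in> L2_proc {k..N}" using sol by (simp add: fbsde_solution_def)
  next
    fix l assume l: "l \<in> {k..<N}"
    then show "AE \<omega> in M. state k \<xi> u (Suc l) \<omega> = state_step k l (state k \<xi> u l) (u l) \<omega>" by simp
    have e: "AE \<omega> in M. X l \<omega> = state k \<xi> u l \<omega>" using eq l by auto
    have "AE \<omega> in M. Z l \<omega> =
          transpose (cA P k l) *v EE l (Z (Suc l)) \<omega>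
        + transpose (cAb P k l) *v EE k (Z (Suc l)) \<omega>
        + transpose (cC P k l) *v EE l (\<lambda>\<omega>'. w l \<omega>' *\<^sub>R Z (Suc l) \<omega>') \<omega>
        + transpose (cCb P k l) *v EE k (\<lambda>\<omega>'. w l \<omega>' *\<^sub>R Z (Suc l) \<omega>') \<omega>
        + cQ P k l *v X l \<omega> + cQb P k l *v EE k (X l) \<omega> + cq P k l"
      using sol l by (simp add: fbsde_solution_def)
    from this e EEeq[OF e] show "AE \<omega> in M. Z l \<omega> =
          transpose (cA P k l) *v EE l (Z (Suc l)) \<omega>
        + transpose (cAb P k l) *v EE k (Z (Suc l)) \<omega>
        + transpose (cC P k l) *v EE l (\<lambda>\<omega>'. w l \<omega>' *\<^sub>R Z (Suc l) \<omega>') \<omega>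
        + transpose (cCb P k l) *v EE k (\<lambda>\<omega>'. w l \<omega>' *\<^sub>R Z (Suc l) \<omega>') \<omega>
        + cQ P k l *v state k \<xi> u l \<omega> + cQb P k l *v EE k (state k \<xi> u l) \<omega> + cq P k l"
      using l by (auto elim: eventually_elim2)
  next
    show "AE \<omega> in M. state k \<xi> u k \<omega> = \<xi> \<omega>" by simp
    have e: "AE \<omega> in M. X N \<omega> = state k \<xi> u N \<omega>" using eq k by auto
    have "AE \<omega> in M. Z N \<omega> = cG P k *v X N \<omega> + cGb P k *v EE k (X N) \<omega> + cg P k"
      using sol by (simp add: fbsde_solution_def)
    from this e EEeq[OF e] show
      "AE \<omega> in M. Z N \<omega> = cG P k *v state k \<xi> u N \<omega> + cGb P k *v EE k (state k \<xi> u N) \<omega> + cg P k"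
      using k by (auto elim: eventually_elim2)
  qed
qed

text \<open>The index counts the steps remaining until \<open>N\<close>, which turns the backward
  recursion into a primitive one: \<open>adjoint k X (N - l)\<close> is the adjoint process at time
  \<open>l\<close>.\<close>

primrec adjoint :: "nat \<Rightarrow> (nat \<Rightarrow> 'a \<Rightarrow> real ^ 'n) \<Rightarrow> nat \<Rightarrow> 'a \<Rightarrow> real ^ 'n" where
  "adjoint k X 0 = (\<lambda>\<omega>. cG P k *v X N \<omega> + cGb P k *v EE k (X N) \<omega> + cg P k)"
| "adjoint k X (Suc j) = (let l = N - Suc j; Z = adjoint k X j in (\<lambda>\<omega>.
          transpose (cA P k l) *v EE l Z \<omega>
        + transpose (cAb P k l) *v EE k Z \<omega>
        + transpose (cC P k l) *v EE l (\<lambda>\<omega>'. w l \<omega>' *\<^sub>R Z \<omega>') \<omega>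
        + transpose (cCb P k l) *v EE k (\<lambda>\<omega>'. w l \<omega>' *\<^sub>R Z \<omega>') \<omega>
        + cQ P k l *v X l \<omega> + cQb P k l *v EE k (X l) \<omega> + cq P k l))"

lemma adjoint_before_end:
  assumes "l < N"
  shows "adjoint k X (N - l) = (let Z = adjoint k X (N - Suc l) in (\<lambda>\<omega>.
          transpose (cA P k l) *v EE l Z \<omega>
        + transpose (cAb P k l) *v EE k Z \<omega>
        + transpose (cC P k l) *v EE l (\<lambda>\<omega>'. w l \<omega>' *\<^sub>R Z \<omega>') \<omega>
        + transpose (cCb P k l) *v EE k (\<lambda>\<omega>'. w l \<omega>' *\<^sub>R Z \<omega>') \<omega>
        + cQ P k l *v X l \<omega> + cQb P k l *v EE k (X l) \<omega> + cq P k l))"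
proof -
  have "N - l = Suc (N - Suc l)" "N - Suc (N - Suc l) = l" using assms by auto
  then show ?thesis by (simp add: Let_def)
qed

text \<open>Induction backwards from \<open>N\<close>. The terms with noise stay square integrable
  by \<open>L2_EE_noise\<close>.\<close>

lemma L2_adjoint:
  assumes X: "\<And>l. l \<in> {k..N} \<Longrightarrow> X l \<in> L2 l" and "k \<le> l" "l \<le> N"
  shows "adjoint k X (N - l) \<in> L2 l"
  using assms(3,2)
proof (induction l rule: inc_induct)
  case base
  then show ?case using X[of N]
    by (auto intro!: L2_add L2_matrix L2_const L2_EE_mono[where j = N])
next
  case (step l)
  then have "adjoint k X (N - Suc l) \<in> L2 (Suc l)" by simp
  then show ?case
    unfolding adjoint_before_end[OF step(2)] Let_def using step X[of l]
    by (intro L2_add L2_matrix L2_const L2_EE_mono[where j = l] L2_EE_mono[where j = "Suc l"]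
        L2_EE_noise_mono[where j = "Suc l"]) auto
qed

lemma ex_fbsde_solution:
  assumes \<xi>: "\<xi> \<in> L2 k" and u: "u \<in> L2_proc {k..<N}" and k: "k < N"
  shows "\<exists>Z. fbsde_solution k \<xi> u (state k \<xi> u) Z"
proof
  let ?X = "state k \<xi> u"
  have X: "?X l \<in> L2 l" if "l \<in> {k..N}" for l
    using L2_state[OF \<xi> u] that by auto
  show "fbsde_solution k \<xi> u ?X (\<lambda>l. adjoint k ?X (N - l))"
    unfolding fbsde_solution_def
    using X L2_adjoint[OF X] adjoint_before_end[of _ k ?X]
    by (auto simp: L2_proc_def Let_def)
qed

section \<open>Costs as conditional expectations of their integrands\<close>

lemma symmetric_coefficients:
  assumes "k < N"
  shows "transpose (cG P k) = cG P k" "transpose (cGb P k) = cGb P k"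
    "\<And>l. k \<le> l \<Longrightarrow> l < N \<Longrightarrow> transpose (cQ P k l) = cQ P k l"
    "\<And>l. k \<le> l \<Longrightarrow> l < N \<Longrightarrow> transpose (cQb P k l) = cQb P k l"
    "\<And>l. k \<le> l \<Longrightarrow> l < N \<Longrightarrow> transpose (cR P k l) = cR P k l"
    "\<And>l. k \<le> l \<Longrightarrow> l < N \<Longrightarrow> transpose (cRb P k l) = cRb P k l"
  using symmetric assms by (auto simp: symmetric_weights_def)

text \<open>The summand of \<open>cost\<close> without its outer \<open>EE1 k\<close>. The averages
  inside the barred quadratic terms remain, since squaring does not commute with averaging.\<close>

definition stage_cost ::
    "nat \<Rightarrow> (nat \<Rightarrow> 'a \<Rightarrow> real ^ 'n) \<Rightarrow> (nat \<Rightarrow> 'a \<Rightarrow> real ^ 'm) \<Rightarrow> nat \<Rightarrow> 'a \<Rightarrow> real" where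
  "stage_cost k X u l = (\<lambda>\<omega>.
          quad (cQ P k l) (X l \<omega>) + quad (cQb P k l) (EE k (X l) \<omega>)
        + quad (cR P k l) (u l \<omega>) + quad (cRb P k l) (EE k (u l) \<omega>)
        + 2 * (cq P k l \<bullet> X l \<omega>) + 2 * (crho P k l \<bullet> u l \<omega>))"

definition pert_stage_cost :: "nat \<Rightarrow> (nat \<Rightarrow> 'a \<Rightarrow> real ^ 'n) \<Rightarrow> nat \<Rightarrow> 'a \<Rightarrow> real" where
  "pert_stage_cost k Y l = (\<lambda>\<omega>. quad (cQ P k l) (Y l \<omega>) + quad (cQb P k l) (EE k (Y l) \<omega>))"

definition terminal_cost :: "nat \<Rightarrow> ('a \<Rightarrow> real ^ 'n) \<Rightarrow> 'a \<Rightarrow> real" where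
  "terminal_cost k x = (\<lambda>\<omega>. quad (cG P k) (x \<omega>) + quad (cGb P k) (EE k x \<omega>) + 2 * (cg P k \<bullet> x \<omega>))"

definition pert_terminal_cost :: "nat \<Rightarrow> ('a \<Rightarrow> real ^ 'n) \<Rightarrow> 'a \<Rightarrow> real" where
  "pert_terminal_cost k y = (\<lambda>\<omega>. quad (cG P k) (y \<omega>) + quad (cGb P k) (EE k y \<omega>))"

lemma integrable_stage_cost:
  assumes "X l \<in> L2 l" "u l \<in> L2 l" "k \<le> l" "l \<le> N"
  shows "integrable M (stage_cost k X u l)"
  unfolding stage_cost_def using assms
  by (intro Bochner_Integration.integrable_add integrable_mult_right integrable_quad[where k = l] integrable_inner_const[where k = l]
      L2_EE_mono[where j = l]) auto

lemma integrable_pert_stage_cost: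
  assumes "Y l \<in> L2 l" "k \<le> l" "l \<le> N"
  shows "integrable M (pert_stage_cost k Y l)"
  unfolding pert_stage_cost_def using assms
  by (intro Bochner_Integration.integrable_add integrable_quad[where k = l] L2_EE_mono[where j = l]) auto

lemma integrable_terminal_cost:
  assumes "x \<in> L2 N" "k \<le> N"
  shows "integrable M (terminal_cost k x)" "integrable M (pert_terminal_cost k x)"
  unfolding terminal_cost_def pert_terminal_cost_def using assms
  by (intro Bochner_Integration.integrable_add integrable_mult_right integrable_quad[where k = N] integrable_inner_const[where k = N]
      L2_EE_mono[where j = N]; simp)+

lemma ceq_refl: "integrable M f \<Longrightarrow> ceq k f f"
  by (simp add: ceq_def)

text \<open>The integrand is what the perturbation formulas expand; measurability is what later
  turns \<open>ceq\<close> between costs into almost sure equality.\<close>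

lemma ceq_cost:
  assumes \<xi>: "\<xi> \<in> L2 k" and u: "u \<in> L2_proc {k..<N}" and k: "k < N"
  shows "ceq k (cost k \<xi> u)
    (\<lambda>\<omega>. (\<Sum>l = k..<N. stage_cost k (state k \<xi> u) u l \<omega>) + terminal_cost k (state k \<xi> u N) \<omega>)"
    and "cost k \<xi> u \<in> borel_measurable (Filt k)"
proof -
  let ?X = "state k \<xi> u"
  have X: "?X l \<in> L2 l" if "k \<le> l" "l \<le> N" for l using L2_state[OF \<xi> u] that by auto
  have uL: "u l \<in> L2 l" if "l \<in> {k..<N}" for l using u that by (auto simp: L2_proc_def)
  have XN: "?X N \<in> L2 N" using X k by simp
  have EX: "EE k (?X N) \<in> L2 k" by (rule L2_EE[OF XN]) (use k in auto)
  have c: "cost k \<xi> u = (\<lambda>\<omega>. (\<Sum>l = k..<N. EE1 k (stage_cost k ?X u l) \<omega>)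
     + (EE1 k (\<lambda>\<omega>'. quad (cG P k) (?X N \<omega>')) \<omega>
     + quad (cGb P k) (EE k (?X N) \<omega>)
     + 2 * EE1 k (\<lambda>\<omega>'. cg P k \<bullet> ?X N \<omega>') \<omega>))"
    unfolding cost_def stage_cost_def Let_def by (simp add: add.assoc)
  show "cost k \<xi> u \<in> borel_measurable (Filt k)"
    unfolding c by (intro borel_measurable_add borel_measurable_sum borel_measurable_times
        borel_measurable_const borel_measurable_cond_exp measurable_quad EX) (use k in auto)
  show "ceq k (cost k \<xi> u) (\<lambda>\<omega>. (\<Sum>l = k..<N. stage_cost k ?X u l \<omega>) + terminal_cost k (?X N) \<omega>)"
    unfolding c terminal_cost_def
    by (intro ceq_add ceq_sum ceq_EE1 ceq_cmult ceq_refl integrable_stage_cost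
        integrable_quad[OF XN] integrable_quad[OF EX] integrable_inner_const[OF XN])
      (use X uL k in auto)
qed

lemma ceq_pert_cost:
  assumes v: "v \<in> L2 k" and k: "k < N"
  shows "ceq k (pert_cost k v)
    (\<lambda>\<omega>. (\<Sum>l = k..<N. pert_stage_cost k (pert_state k v) l \<omega>)
      + quad (cR P k k + cRb P k k) (v \<omega>) + pert_terminal_cost k (pert_state k v N) \<omega>)"
    and "pert_cost k v \<in> borel_measurable (Filt k)"
proof -
  let ?Y = "pert_state k v"
  have Y: "?Y l \<in> L2 l" if "k \<le> l" "l \<le> N" for l using L2_pert_state[OF v] that by auto
  have YN: "?Y N \<in> L2 N" using Y k by simp
  have EY: "EE k (?Y N) \<in> L2 k" by (rule L2_EE[OF YN]) (use k in auto)
  have c: "pert_cost k v = (\<lambda>\<omega>. (\<Sum>l = k..<N. EE1 k (pert_stage_cost k ?Y l) \<omega>)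
     + quad (cR P k k + cRb P k k) (v \<omega>)
     + (EE1 k (\<lambda>\<omega>'. quad (cG P k) (?Y N \<omega>')) \<omega>
     + quad (cGb P k) (EE k (?Y N) \<omega>)))"
    unfolding pert_cost_def pert_stage_cost_def Let_def by (simp add: add.assoc)
  show "pert_cost k v \<in> borel_measurable (Filt k)"
    unfolding c by (intro borel_measurable_add borel_measurable_sum
        borel_measurable_cond_exp measurable_quad EY v) (use k in auto)
  show "ceq k (pert_cost k v)
    (\<lambda>\<omega>. (\<Sum>l = k..<N. pert_stage_cost k ?Y l \<omega>)
      + quad (cR P k k + cRb P k k) (v \<omega>) + pert_terminal_cost k (?Y N) \<omega>)"
    unfolding c pert_terminal_cost_def
    by (intro ceq_add ceq_sum ceq_EE1 ceq_refl integrable_pert_stage_cost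
        integrable_quad[OF YN] integrable_quad[OF EY] integrable_quad[OF v])
      (use Y k in auto)
qed

section \<open>Duality between the response and the adjoint process\<close>

text \<open>Half the gradient of the stage cost in the state, under conditioning at
  \<open>k\<close>; it is also the source term of the backward equation.\<close>

definition state_gradient :: "nat \<Rightarrow> (nat \<Rightarrow> 'a \<Rightarrow> real ^ 'n) \<Rightarrow> nat \<Rightarrow> 'a \<Rightarrow> real ^ 'n" where
  "state_gradient k X l = (\<lambda>\<omega>. cQ P k l *v X l \<omega> + cQb P k l *v EE k (X l) \<omega> + cq P k l)"

lemma L2_state_gradient:
  assumes "X l \<in> L2 l" "k \<le> l" "l \<le> N"
  shows "state_gradient k X l \<in> L2 l"
  unfolding state_gradient_def using assms
  by (intro L2_add L2_matrix L2_const L2_EE_mono[where j = l]) auto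

text \<open>Transposes one step of the homogeneous state equation. As \<open>Y\<close> is known at
  time \<open>l\<close>, the unbarred terms average \<open>Z\<close> at \<open>l\<close>. The barred
  terms use that \<open>EE k\<close> is self-adjoint: the average passes from \<open>Y\<close> to
  both factors and then to \<open>Z\<close> alone.\<close>

lemma ceq_adjoint_step:
  assumes Z: "Z \<in> L2 (Suc l)" and Y: "Y \<in> L2 l" and kl: "k \<le> l" "l < N"
  shows "ceq k
    (\<lambda>\<omega>. ((A *v Y \<omega> + Ab *v EE k Y \<omega>) + w l \<omega> *\<^sub>R (C *v Y \<omega> + Cb *v EE k Y \<omega>)) \<bullet> Z \<omega>)
    (\<lambda>\<omega>. Y \<omega> \<bullet> (transpose A *v EE l Z \<omega> + transpose Ab *v EE k Z \<omega>
        + transpose C *v EE l (\<lambda>\<omega>'. w l \<omega>' *\<^sub>R Z \<omega>') \<omega>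
        + transpose Cb *v EE k (\<lambda>\<omega>'. w l \<omega>' *\<^sub>R Z \<omega>') \<omega>))"
proof -
  let ?W = "\<lambda>\<omega>. w l \<omega> *\<^sub>R Z \<omega>"
  have N: "k \<le> N" "l \<le> N" "Suc l \<le> N" using kl by auto
  note EY = L2_EE[OF Y N(2,1)]
  have EYl: "EE k Y \<in> L2 l" by (rule L2_mono[OF EY kl(1)])
  note a = L2_EE[OF Z N(3,2)] and a' = L2_EE[OF Z N(3,1)]
    and b = L2_EE_noise[OF Z N(3) order_refl kl(2)] and b' = L2_EE_noise[OF Z N(3) kl]
  have 1: "ceq k (\<lambda>\<omega>. (A *v Y \<omega>) \<bullet> Z \<omega>) (\<lambda>\<omega>. (A *v Y \<omega>) \<bullet> EE l Z \<omega>)"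
    by (rule ceq_inner_EE[OF kl(1) N(2) L2_matrix[OF Y N(2)] Z N(3)])
  have 2: "ceq k (\<lambda>\<omega>. (Ab *v EE k Y \<omega>) \<bullet> Z \<omega>) (\<lambda>\<omega>. (Ab *v Y \<omega>) \<bullet> EE k Z \<omega>)"
  proof -
    have "ceq k (\<lambda>\<omega>. (Ab *v EE k Y \<omega>) \<bullet> Z \<omega>) (\<lambda>\<omega>. (Ab *v EE k Y \<omega>) \<bullet> EE k Z \<omega>)"
      by (rule ceq_inner_EE[OF order_refl N(1) L2_matrix[OF EY N(1)] Z N(3)])
    also have "(\<lambda>\<omega>. (Ab *v EE k Y \<omega>) \<bullet> EE k Z \<omega>) = (\<lambda>\<omega>. (transpose Ab *v EE k Z \<omega>) \<bullet> EE k Y \<omega>)"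
      by (simp only: inner_transpose)
    also have "ceq k \<dots> (\<lambda>\<omega>. (transpose Ab *v EE k Z \<omega>) \<bullet> Y \<omega>)"
      by (rule ceq_sym, rule ceq_inner_EE[OF order_refl N(1) L2_matrix[OF a' N(1)] Y N(2)])
    finally show ?thesis by (simp only: inner_transpose)
  qed
  have 3: "ceq k (\<lambda>\<omega>. (C *v Y \<omega>) \<bullet> ?W \<omega>) (\<lambda>\<omega>. (C *v Y \<omega>) \<bullet> EE l ?W \<omega>)"
    by (rule ceq_inner_EE_noise[OF kl L2_matrix[OF Y N(2)] Z N(3)])
  have 4: "ceq k (\<lambda>\<omega>. (Cb *v EE k Y \<omega>) \<bullet> ?W \<omega>) (\<lambda>\<omega>. (Cb *v Y \<omega>) \<bullet> EE k ?W \<omega>)"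
  proof -
    have "ceq k (\<lambda>\<omega>. (Cb *v EE k Y \<omega>) \<bullet> ?W \<omega>) (\<lambda>\<omega>. (Cb *v EE k Y \<omega>) \<bullet> EE k ?W \<omega>)"
    \<comment> \<open>\<open>ceq_inner_EE_noise\<close> conditions at the time \<open>l\<close> of
      the noise, whereas here the conditioning is at \<open>k\<close>. The product is integrable
      because \<open>Cb *v EE k Y\<close>, regarded as known at time \<open>l\<close>, stays in
      \<open>L2\<close> when multiplied by \<open>w l\<close>.\<close>
    proof (rule ceq_inner_EE_measurable[OF order_refl N(1)])
      note m = L2_matrix[OF EY N(1), of Cb] and ml = L2_matrix[OF EYl N(2), of Cb]
      show "(\<lambda>\<omega>. Cb *v EE k Y \<omega>) \<in> borel_measurable (Filt k)" by (rule L2_measurable[OF m])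
      show "?W \<in> borel_measurable M"
        by (intro borel_measurable_scaleR noise_measurable kl L2_measurable_M[OF Z N(3)])
      show "integrable M (\<lambda>\<omega>. (Cb *v EE k Y \<omega>) $ i * (w l \<omega> *\<^sub>R Z \<omega>) $ i)" for i
        using integrable_component_mult[OF L2_noise[OF ml kl(2)] Z N(3,3), of i i] by (simp add: mult_ac)
    qed
    also have "(\<lambda>\<omega>. (Cb *v EE k Y \<omega>) \<bullet> EE k ?W \<omega>) = (\<lambda>\<omega>. (transpose Cb *v EE k ?W \<omega>) \<bullet> EE k Y \<omega>)"
      by (simp only: inner_transpose)
    also have "ceq k \<dots> (\<lambda>\<omega>. (transpose Cb *v EE k ?W \<omega>) \<bullet> Y \<omega>)"
      by (rule ceq_sym, rule ceq_inner_EE[OF order_refl N(1) L2_matrix[OF b' N(1)] Y N(2)])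
    finally show ?thesis by (simp only: inner_transpose)
  qed
  from ceq_add[OF ceq_add[OF ceq_add[OF 1 2 N(1)] 3 N(1)] 4 N(1)]
  show ?thesis
    by (simp add: inner_matrix_left inner_add_left inner_add_right add.assoc distrib_left)
qed

lemma ceq_adjoint_first_step:
  assumes Z: "Z \<in> L2 (Suc k)" and v: "v \<in> L2 k" and k: "k < N"
  shows "ceq k (\<lambda>\<omega>. (B *v v \<omega> + w k \<omega> *\<^sub>R (D *v v \<omega>)) \<bullet> Z \<omega>)
    (\<lambda>\<omega>. v \<omega> \<bullet> (transpose B *v EE k Z \<omega> + transpose D *v EE k (\<lambda>\<omega>'. w k \<omega>' *\<^sub>R Z \<omega>') \<omega>))"
proof -
  have N: "k \<le> N" "Suc k \<le> N" using k by auto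
  from ceq_add[OF ceq_inner_EE[OF order_refl N(1) L2_matrix[OF v N(1)] Z N(2)]
      ceq_inner_EE_noise[OF order_refl k L2_matrix[OF v N(1)] Z N(2)] N(1), of B D]
  show ?thesis
    by (simp add: inner_matrix_left inner_add_left inner_add_right)
qed

text \<open>Summation by parts: the adjoint process turns the first variation of the state cost into a
  multiple of the perturbing control.\<close>

lemma ceq_duality:
  assumes sol: "fbsde_solution k \<xi> u X Z" and v: "v \<in> L2 k" and n: "Suc k \<le> n" "n \<le> N"
  shows "ceq k
    (\<lambda>\<omega>. (\<Sum>l = k..<n. pert_state k v l \<omega> \<bullet> state_gradient k X l \<omega>) + pert_state k v n \<omega> \<bullet> Z n \<omega>)
    (\<lambda>\<omega>. v \<omega> \<bullet> (transpose (cB P k k + cBb P k k) *v EE k (Z (Suc k)) \<omega>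
        + transpose (cD P k k + cDb P k k) *v EE k (\<lambda>\<omega>'. w k \<omega>' *\<^sub>R Z (Suc k) \<omega>') \<omega>))"
  using n
proof (induction n rule: dec_induct)
  \<comment> \<open>The sum has the single term \<open>l = k\<close>, which vanishes since the
    response starts from zero.\<close>
  case base
  then have k: "k < N" by simp
  have "Z (Suc k) \<in> L2 (Suc k)" using sol k by (auto simp: fbsde_solution_def L2_proc_def)
  from ceq_adjoint_first_step[OF this v k, of "cB P k k + cBb P k k" "cD P k k + cDb P k k"]
  show ?case by simp
next
  case (step n)
  let ?Y = "pert_state k v"
  have n: "k \<le> n" "n < N" "n \<le> N" "k < n" "k \<le> N" using step by auto
  have Z: "Z n \<in> L2 n" "Z (Suc n) \<in> L2 (Suc n)" and X: "X n \<in> L2 n"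
    using sol n by (auto simp: fbsde_solution_def L2_proc_def)
  note Y = L2_pert_state[OF v n(1,3)]
  have H: "state_gradient k X n \<in> L2 n" using L2_state_gradient X n by blast
  have Zn: "AE \<omega> in M. transpose (cA P k n) *v EE n (Z (Suc n)) \<omega>
        + transpose (cAb P k n) *v EE k (Z (Suc n)) \<omega>
        + transpose (cC P k n) *v EE n (\<lambda>\<omega>'. w n \<omega>' *\<^sub>R Z (Suc n) \<omega>') \<omega>
        + transpose (cCb P k n) *v EE k (\<lambda>\<omega>'. w n \<omega>' *\<^sub>R Z (Suc n) \<omega>') \<omega>
        = Z n \<omega> - state_gradient k X n \<omega>"
  proof -
    have "AE \<omega> in M. Z n \<omega> =
          transpose (cA P k n) *v EE n (Z (Suc n)) \<omega>
        + transpose (cAb P k n) *v EE k (Z (Suc n)) \<omega>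
        + transpose (cC P k n) *v EE n (\<lambda>\<omega>'. w n \<omega>' *\<^sub>R Z (Suc n) \<omega>') \<omega>
        + transpose (cCb P k n) *v EE k (\<lambda>\<omega>'. w n \<omega>' *\<^sub>R Z (Suc n) \<omega>') \<omega>
        + cQ P k n *v X n \<omega> + cQb P k n *v EE k (X n) \<omega> + cq P k n"
      using sol n by (simp add: fbsde_solution_def)
    then show ?thesis by eventually_elim (simp add: state_gradient_def)
  qed
  \<comment> \<open>The transposed step produces the homogeneous part of the backward equation, that
    is, \<open>Z n\<close> without its source term.\<close>
  have "ceq k (\<lambda>\<omega>. ?Y (Suc n) \<omega> \<bullet> Z (Suc n) \<omega>) (\<lambda>\<omega>. ?Y n \<omega> \<bullet> (Z n \<omega> - state_gradient k X n \<omega>))"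
    unfolding pert_state_Suc[OF n(4)]
  proof (rule ceq_trans[OF ceq_adjoint_step[OF Z(2) Y n(1,2)]], rule ceq_AE)
    note c = ceq_adjoint_step[OF Z(2) Y n(1,2), of "cA P k n" "cAb P k n" "cC P k n" "cCb P k n"]
    then show "integrable M (\<lambda>\<omega>. ?Y n \<omega> \<bullet> (transpose (cA P k n) *v EE n (Z (Suc n)) \<omega>
        + transpose (cAb P k n) *v EE k (Z (Suc n)) \<omega>
        + transpose (cC P k n) *v EE n (\<lambda>\<omega>'. w n \<omega>' *\<^sub>R Z (Suc n) \<omega>') \<omega>
        + transpose (cCb P k n) *v EE k (\<lambda>\<omega>'. w n \<omega>' *\<^sub>R Z (Suc n) \<omega>') \<omega>))"
      by (simp add: ceq_def)
    show "integrable M (\<lambda>\<omega>. ?Y n \<omega> \<bullet> (Z n \<omega> - state_gradient k X n \<omega>))"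
      by (rule integrable_inner[OF Y L2_diff[OF Z(1) H n(3)] n(3,3)])
    show "AE \<omega> in M. ?Y n \<omega> \<bullet> (transpose (cA P k n) *v EE n (Z (Suc n)) \<omega>
        + transpose (cAb P k n) *v EE k (Z (Suc n)) \<omega>
        + transpose (cC P k n) *v EE n (\<lambda>\<omega>'. w n \<omega>' *\<^sub>R Z (Suc n) \<omega>') \<omega>
        + transpose (cCb P k n) *v EE k (\<lambda>\<omega>'. w n \<omega>' *\<^sub>R Z (Suc n) \<omega>') \<omega>)
        = ?Y n \<omega> \<bullet> (Z n \<omega> - state_gradient k X n \<omega>)"
      using Zn by eventually_elim simp
  qed (rule n)
  moreover have "integrable M (\<lambda>\<omega>. \<Sum>l = k..<Suc n. ?Y l \<omega> \<bullet> state_gradient k X l \<omega>)"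
  proof (rule Bochner_Integration.integrable_sum)
    fix l assume "l \<in> {k..<Suc n}"
    then have l: "k \<le> l" "l \<le> N" using n by auto
    then have "X l \<in> L2 l" using sol by (auto simp: fbsde_solution_def L2_proc_def)
    then show "integrable M (\<lambda>\<omega>. ?Y l \<omega> \<bullet> state_gradient k X l \<omega>)"
      using L2_pert_state[OF v l] L2_state_gradient l by (blast intro: integrable_inner)
  qed
  ultimately have "ceq k
      (\<lambda>\<omega>. (\<Sum>l = k..<Suc n. ?Y l \<omega> \<bullet> state_gradient k X l \<omega>) + ?Y (Suc n) \<omega> \<bullet> Z (Suc n) \<omega>)
      (\<lambda>\<omega>. (\<Sum>l = k..<Suc n. ?Y l \<omega> \<bullet> state_gradient k X l \<omega>) + ?Y n \<omega> \<bullet> (Z n \<omega> - state_gradient k X n \<omega>))"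
    by (intro ceq_add ceq_refl n)
  \<comment> \<open>The source term cancels the summand \<open>l = n\<close>, so the expression for
    \<open>Suc n\<close> telescopes to the one for \<open>n\<close>.\<close>
  also have "(\<lambda>\<omega>. (\<Sum>l = k..<Suc n. ?Y l \<omega> \<bullet> state_gradient k X l \<omega>) + ?Y n \<omega> \<bullet> (Z n \<omega> - state_gradient k X n \<omega>))
      = (\<lambda>\<omega>. (\<Sum>l = k..<n. ?Y l \<omega> \<bullet> state_gradient k X l \<omega>) + ?Y n \<omega> \<bullet> Z n \<omega>)"
    using n(1) by (simp add: inner_diff_right)
  also have "ceq k \<dots> (\<lambda>\<omega>. v \<omega> \<bullet> (transpose (cB P k k + cBb P k k) *v EE k (Z (Suc k)) \<omega>
        + transpose (cD P k k + cDb P k k) *v EE k (\<lambda>\<omega>'. w k \<omega>' *\<^sub>R Z (Suc k) \<omega>') \<omega>))"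
    using step n by simp
  finally show ?case .
qed

section \<open>Quadratic expansion of the cost\<close>

definition stationarity_residual ::
    "nat \<Rightarrow> (nat \<Rightarrow> 'a \<Rightarrow> real ^ 'm) \<Rightarrow> (nat \<Rightarrow> 'a \<Rightarrow> real ^ 'n) \<Rightarrow> 'a \<Rightarrow> real ^ 'm" where
  "stationarity_residual k u Z = (\<lambda>\<omega>.
          (cR P k k + cRb P k k) *v u k \<omega>
        + transpose (cB P k k + cBb P k k) *v EE k (Z (Suc k)) \<omega>
        + transpose (cD P k k + cDb P k k) *v EE k (\<lambda>\<omega>'. w k \<omega>' *\<^sub>R Z (Suc k) \<omega>') \<omega>
        + crho P k k)"

lemma stationary_iff: "stationary k u Z \<longleftrightarrow> (AE \<omega> in M. stationarity_residual k u Z \<omega> = 0)"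
  unfolding stationary_def stationarity_residual_def by (simp only: eq_commute)

lemma L2_stationarity_residual:
  assumes "u k \<in> L2 k" "Z (Suc k) \<in> L2 (Suc k)" "k < N"
  shows "stationarity_residual k u Z \<in> L2 k"
  unfolding stationarity_residual_def using assms
  by (intro L2_add L2_matrix L2_const L2_EE[where j = "Suc k"] L2_EE_noise[where j = "Suc k"]) auto

text \<open>The cross term of \<open>cQb\<close> pairs the averages of both states, whereas
  \<open>state_gradient\<close> is paired with the response itself. The two agree only after
  conditioning at \<open>k\<close>, which is why the relation is \<open>ceq\<close>.\<close>

lemma ceq_stage_cost_perturbed:
  fixes v :: "'a \<Rightarrow> real ^ 'm" and c :: real
  assumes \<xi>: "\<xi> \<in> L2 k" and u: "u \<in> L2_proc {k..<N}" and v: "v \<in> L2 k"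
    and kl: "k \<le> l" "l < N"
  defines "u' \<equiv> u(k := \<lambda>\<omega>. u k \<omega> + c *\<^sub>R v \<omega>)"
  shows "ceq k (stage_cost k (state k \<xi> u') u' l)
    (\<lambda>\<omega>. stage_cost k (state k \<xi> u) u l \<omega>
      + (2 * c) * (pert_state k v l \<omega> \<bullet> state_gradient k (state k \<xi> u) l \<omega>)
      + c\<^sup>2 * pert_stage_cost k (pert_state k v) l \<omega>
      + (if l = k then (2 * c) * (v \<omega> \<bullet> ((cR P k k + cRb P k k) *v u k \<omega> + crho P k k))
          + c\<^sup>2 * quad (cR P k k + cRb P k k) (v \<omega>) else 0))"
proof -
  let ?X' = "state k \<xi> u'" and ?X = "state k \<xi> u" and ?Y = "pert_state k v"
  let ?r = "\<lambda>\<omega>. (if l = k then (2 * c) * (v \<omega> \<bullet> ((cR P k k + cRb P k k) *v u k \<omega> + crho P k k))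
          + c\<^sup>2 * quad (cR P k k + cRb P k k) (v \<omega>) else 0)"
  have N: "l \<le> N" "k \<le> N" "k < N" using kl by auto
  have uk: "u k \<in> L2 k" and ul: "u l \<in> L2 l" using u kl by (auto simp: L2_proc_def)
  have ukv: "(\<lambda>\<omega>. u k \<omega> + c *\<^sub>R v \<omega>) \<in> L2 k" by (intro L2_add L2_scaleR uk v N)
  have u': "u' \<in> L2_proc {k..<N}" unfolding u'_def by (intro L2_proc_update u ukv)
  have ul': "u' l \<in> L2 l" using u' kl by (auto simp: L2_proc_def)
  note X = L2_state[OF \<xi> u kl(1) N(1)] and X' = L2_state[OF \<xi> u' kl(1) N(1)]
    and Y = L2_pert_state[OF v kl(1) N(1)]
  note EX = L2_EE[OF X N(1,2)] and EY = L2_EE[OF Y N(1,2)]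
  note sym = symmetric_coefficients[OF N(3)]
  have e: "AE \<omega> in M. ?X' l \<omega> = ?X l \<omega> + c *\<^sub>R ?Y l \<omega>"
    unfolding u'_def by (rule state_perturbed[OF \<xi> u v kl(1) N(1)])
  have E1: "AE \<omega> in M. EE k (?X' l) \<omega> = EE k (\<lambda>\<omega>. ?X l \<omega> + c *\<^sub>R ?Y l \<omega>) \<omega>"
    using X X' Y N by (intro EE_cong[OF e] L2_measurable_M[where k = l] L2_add L2_scaleR)
  note E2 = EE_add_scaleR[OF X Y N(1,2), of c]
  \<comment> \<open>The perturbed control differs from \<open>u\<close> only at
    \<open>l = k\<close>, where both are known, so averaging leaves them fixed and \<open>cR\<close>
    and \<open>cRb\<close> act as their sum.\<close>
  have control: "AE \<omega> in M. quad (cR P k l) (u' l \<omega>) + quad (cRb P k l) (EE k (u' l) \<omega>)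
        + 2 * (crho P k l \<bullet> u' l \<omega>)
      = quad (cR P k l) (u l \<omega>) + quad (cRb P k l) (EE k (u l) \<omega>) + 2 * (crho P k l \<bullet> u l \<omega>) + ?r \<omega>"
  proof (cases "l = k")
    case True
    have q: "quad (cR P k k + cRb P k k) a = quad (cR P k k) a + quad (cRb P k k) a" for a
      by (simp add: quad_def matrix_vector_mult_add_rdistrib inner_add_right)
    from EE_adapted[OF uk N(2)] EE_adapted[OF ukv N(2)] show ?thesis
      by eventually_elim
        (use True kl in \<open>simp add: u'_def quad_add_scaleR sym q matrix_vector_mult_add_rdistrib
          inner_add_left inner_add_right inner_commute algebra_simps\<close>)
  next
    case False
    then have "u' l = u l" by (simp add: u'_def)
    then show ?thesis using False by simp
  qed
  \<comment> \<open>All terms except the cross term of \<open>cQb\<close>; these need no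
    conditioning.\<close>
  let ?g = "\<lambda>\<omega>. (stage_cost k ?X u l \<omega> + (2 * c) * (?Y l \<omega> \<bullet> (cQ P k l *v ?X l \<omega> + cq P k l))
      + c\<^sup>2 * pert_stage_cost k ?Y l \<omega> + ?r \<omega>)"
  have r: "integrable M ?r"
  proof -
    have "integrable M (\<lambda>\<omega>. (2 * c) * (v \<omega> \<bullet> ((cR P k k + cRb P k k) *v u k \<omega> + crho P k k))
          + c\<^sup>2 * quad (cR P k k + cRb P k k) (v \<omega>))"
      by (intro Bochner_Integration.integrable_add integrable_mult_right integrable_quad[OF v N(2)]
          integrable_inner[OF v L2_add[OF L2_matrix[OF uk N(2)] L2_const N(2)] N(2,2)])
    then show ?thesis by (cases "l = k") simp_all
  qed
  have g: "integrable M ?g"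
    by (intro Bochner_Integration.integrable_add integrable_mult_right r
        integrable_stage_cost[where X = ?X and u = u, OF X ul kl(1) N(1)]
        integrable_pert_stage_cost[where Y = ?Y, OF Y kl(1) N(1)]
        integrable_inner[OF Y L2_add[OF L2_matrix[OF X N(1)] L2_const N(1)] N(1,1)])
  have "ceq k (stage_cost k ?X' u' l) (\<lambda>\<omega>. ?g \<omega> + (2 * c) * ((cQb P k l *v EE k (?X l) \<omega>) \<bullet> EE k (?Y l) \<omega>))"
  proof (rule ceq_AE)
    show "integrable M (stage_cost k ?X' u' l)"
      by (rule integrable_stage_cost[where X = ?X' and u = u', OF X' ul' kl(1) N(1)])
    show "integrable M (\<lambda>\<omega>. ?g \<omega> + (2 * c) * ((cQb P k l *v EE k (?X l) \<omega>) \<bullet> EE k (?Y l) \<omega>))"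
      by (intro Bochner_Integration.integrable_add[OF g] integrable_mult_right
          integrable_inner[OF L2_matrix[OF EX N(2)] EY N(2,2)])
    from e E1 E2 control
    show "AE \<omega> in M. stage_cost k ?X' u' l \<omega>
        = ?g \<omega> + (2 * c) * ((cQb P k l *v EE k (?X l) \<omega>) \<bullet> EE k (?Y l) \<omega>)"
    proof eventually_elim
      case (elim \<omega>)
      note E = trans[OF elim(2,3)]
      show ?case
        unfolding stage_cost_def pert_stage_cost_def elim(1) E
        using elim(4) sym(3,4)[OF kl]
        by (simp add: quad_add_scaleR inner_add_right inner_commute distrib_left)
    qed
  qed (rule N)
  also have "ceq k \<dots> (\<lambda>\<omega>. ?g \<omega> + (2 * c) * ((cQb P k l *v EE k (?X l) \<omega>) \<bullet> ?Y l \<omega>))"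
    by (intro ceq_add ceq_refl[OF g] ceq_cmult ceq_sym[OF ceq_inner_EE[OF order_refl N(2) L2_matrix[OF EX N(2)] Y N(1)]] N)
  also have "\<dots> = (\<lambda>\<omega>. stage_cost k ?X u l \<omega> + (2 * c) * (?Y l \<omega> \<bullet> state_gradient k ?X l \<omega>)
      + c\<^sup>2 * pert_stage_cost k ?Y l \<omega> + ?r \<omega>)"
    by (simp add: state_gradient_def inner_add_right inner_commute distrib_left add_ac)
  finally show ?thesis .
qed

text \<open>The terminal value \<open>z\<close> of the adjoint process is half the gradient of the
  terminal cost. As for the stage costs, the barred cross term requires conditioning at
  \<open>k\<close>.\<close>

lemma ceq_terminal_cost_perturbed:
  assumes x: "x \<in> L2 N" and y: "y \<in> L2 N" and x': "x' \<in> L2 N" and k: "k < N"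
    and e: "AE \<omega> in M. x' \<omega> = x \<omega> + c *\<^sub>R y \<omega>"
    and z: "AE \<omega> in M. z \<omega> = cG P k *v x \<omega> + cGb P k *v EE k x \<omega> + cg P k" "z \<in> L2 N"
  shows "ceq k (terminal_cost k x')
    (\<lambda>\<omega>. terminal_cost k x \<omega> + (2 * c) * (y \<omega> \<bullet> z \<omega>) + c\<^sup>2 * pert_terminal_cost k y \<omega>)"
proof -
  have N: "k \<le> N" "N \<le> N" using k by auto
  note Ex = L2_EE[OF x N(2,1)] and Ey = L2_EE[OF y N(2,1)]
  note sym = symmetric_coefficients(1,2)[OF k]
  have E1: "AE \<omega> in M. EE k x' \<omega> = EE k (\<lambda>\<omega>. x \<omega> + c *\<^sub>R y \<omega>) \<omega>"
    using x y x' N by (intro EE_cong[OF e] L2_measurable_M[where k = N] L2_add L2_scaleR)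
  note E2 = EE_add_scaleR[OF x y N(2,1), of c]
  let ?g = "\<lambda>\<omega>. terminal_cost k x \<omega> + (2 * c) * (y \<omega> \<bullet> (cG P k *v x \<omega> + cg P k))
      + c\<^sup>2 * pert_terminal_cost k y \<omega>"
  have g: "integrable M ?g"
    by (intro Bochner_Integration.integrable_add integrable_mult_right
        integrable_terminal_cost[OF x N(1)] integrable_terminal_cost[OF y N(1)]
        integrable_inner[OF y L2_add[OF L2_matrix[OF x N(2)] L2_const N(2)] N(2,2)])
  have "ceq k (terminal_cost k x') (\<lambda>\<omega>. ?g \<omega> + (2 * c) * ((cGb P k *v EE k x \<omega>) \<bullet> EE k y \<omega>))"
  proof (rule ceq_AE)
    show "integrable M (terminal_cost k x')" by (rule integrable_terminal_cost[OF x' N(1)])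
    show "integrable M (\<lambda>\<omega>. ?g \<omega> + (2 * c) * ((cGb P k *v EE k x \<omega>) \<bullet> EE k y \<omega>))"
      by (intro Bochner_Integration.integrable_add[OF g] integrable_mult_right
          integrable_inner[OF L2_matrix[OF Ex N(1)] Ey N(1,1)])
    from e E1 E2
    show "AE \<omega> in M. terminal_cost k x' \<omega> = ?g \<omega> + (2 * c) * ((cGb P k *v EE k x \<omega>) \<bullet> EE k y \<omega>)"
    proof eventually_elim
      case (elim \<omega>)
      note E = trans[OF elim(2,3)]
      show ?case
        unfolding terminal_cost_def pert_terminal_cost_def elim(1) E
        by (simp add: sym quad_add_scaleR inner_add_right inner_commute distrib_left)
    qed
  qed (rule N)
  also have "ceq k \<dots> (\<lambda>\<omega>. ?g \<omega> + (2 * c) * ((cGb P k *v EE k x \<omega>) \<bullet> y \<omega>))"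
    by (intro ceq_add ceq_refl[OF g] ceq_cmult ceq_sym[OF ceq_inner_EE[OF order_refl N(1) L2_matrix[OF Ex N(1)] y N(2)]] N)
  also have "ceq k \<dots> (\<lambda>\<omega>. terminal_cost k x \<omega> + (2 * c) * (y \<omega> \<bullet> z \<omega>) + c\<^sup>2 * pert_terminal_cost k y \<omega>)"
  proof (rule ceq_AE)
    show "integrable M (\<lambda>\<omega>. ?g \<omega> + (2 * c) * ((cGb P k *v EE k x \<omega>) \<bullet> y \<omega>))"
      by (intro Bochner_Integration.integrable_add[OF g] integrable_mult_right
          integrable_inner[OF L2_matrix[OF Ex N(1)] y N])
    show "integrable M (\<lambda>\<omega>. terminal_cost k x \<omega> + (2 * c) * (y \<omega> \<bullet> z \<omega>) + c\<^sup>2 * pert_terminal_cost k y \<omega>)"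
      by (intro Bochner_Integration.integrable_add integrable_mult_right
          integrable_terminal_cost[OF x N(1)] integrable_terminal_cost[OF y N(1)]
          integrable_inner[OF y z(2) N(2,2)])
    from z(1) show "AE \<omega> in M. ?g \<omega> + (2 * c) * ((cGb P k *v EE k x \<omega>) \<bullet> y \<omega>)
        = terminal_cost k x \<omega> + (2 * c) * (y \<omega> \<bullet> z \<omega>) + c\<^sup>2 * pert_terminal_cost k y \<omega>"
      by eventually_elim (simp add: inner_add_right inner_commute distrib_left)
  qed (rule N)
  finally show ?thesis .
qed

text \<open>The expansion is exact because the state depends affinely on the control and the cost
  quadratically on both. It is computed with \<open>ceq\<close> on integrands; both sides are known
  at time \<open>k\<close>, so it holds almost surely.\<close>

lemma cost_perturbed:
  fixes v :: "'a \<Rightarrow> real ^ 'm" and c :: real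
  assumes sol: "fbsde_solution k \<xi> u X Z"
    and \<xi>: "\<xi> \<in> L2 k" and u: "u \<in> L2_proc {k..<N}" and v: "v \<in> L2 k" and k: "k < N"
  shows "AE \<omega> in M. cost k \<xi> (u(k := \<lambda>\<omega>. u k \<omega> + c *\<^sub>R v \<omega>)) \<omega>
    = cost k \<xi> u \<omega> + (2 * c) * (v \<omega> \<bullet> stationarity_residual k u Z \<omega>) + c\<^sup>2 * pert_cost k v \<omega>"
proof -
  define u' where "u' = u(k := \<lambda>\<omega>. u k \<omega> + c *\<^sub>R v \<omega>)"
  let ?X = "state k \<xi> u" and ?X' = "state k \<xi> u'" and ?Y = "pert_state k v"
  have N: "k \<le> N" "N \<le> N" "Suc k \<le> N" using k by auto
  note sol' = fbsde_solution_state[OF sol \<xi> u k]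
  have Z: "Z N \<in> L2 N" "Z (Suc k) \<in> L2 (Suc k)"
    and ZN: "AE \<omega> in M. Z N \<omega> = cG P k *v ?X N \<omega> + cGb P k *v EE k (?X N) \<omega> + cg P k"
    using sol' N by (auto simp: fbsde_solution_def L2_proc_def)
  have uk: "u k \<in> L2 k" using u k by (auto simp: L2_proc_def)
  have u': "u' \<in> L2_proc {k..<N}"
    unfolding u'_def by (intro L2_proc_update u L2_add L2_scaleR uk v N)
  note X = L2_state[OF \<xi> u N(1,2)] and X' = L2_state[OF \<xi> u' N(1,2)] and Y = L2_pert_state[OF v N(1,2)]
  note res = L2_stationarity_residual[where u = u and Z = Z, OF uk Z(2) k]
  let ?lin = "\<lambda>\<omega>. v \<omega> \<bullet> ((cR P k k + cRb P k k) *v u k \<omega> + crho P k k)"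
  let ?r = "\<lambda>\<omega>. (2 * c) * ?lin \<omega> + c\<^sup>2 * quad (cR P k k + cRb P k k) (v \<omega>)"
  let ?D = "\<lambda>\<omega>. (\<Sum>l = k..<N. ?Y l \<omega> \<bullet> state_gradient k ?X l \<omega>) + ?Y N \<omega> \<bullet> Z N \<omega>"
  let ?D' = "\<lambda>\<omega>. v \<omega> \<bullet> (transpose (cB P k k + cBb P k k) *v EE k (Z (Suc k)) \<omega>
        + transpose (cD P k k + cDb P k k) *v EE k (\<lambda>\<omega>'. w k \<omega>' *\<^sub>R Z (Suc k) \<omega>') \<omega>)"
  let ?T = "\<lambda>\<omega>. (\<Sum>l = k..<N. stage_cost k ?X u l \<omega>) + terminal_cost k (?X N) \<omega>"
  let ?S = "\<lambda>\<omega>. (\<Sum>l = k..<N. pert_stage_cost k ?Y l \<omega>)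
      + quad (cR P k k + cRb P k k) (v \<omega>) + pert_terminal_cost k (?Y N) \<omega>"
  have lin: "integrable M ?lin"
    by (rule integrable_inner[OF v L2_add[OF L2_matrix[OF uk N(1)] L2_const N(1)] N(1,1)])
  have e: "AE \<omega> in M. ?X' N \<omega> = ?X N \<omega> + c *\<^sub>R ?Y N \<omega>"
    unfolding u'_def by (rule state_perturbed[OF \<xi> u v N(1,2)])
  have "ceq k (cost k \<xi> u') (\<lambda>\<omega>. (\<Sum>l = k..<N. stage_cost k ?X' u' l \<omega>) + terminal_cost k (?X' N) \<omega>)"
    by (rule ceq_cost[OF \<xi> u' k])
  also have "ceq k \<dots> (\<lambda>\<omega>. (\<Sum>l = k..<N. stage_cost k ?X u l \<omega>
        + (2 * c) * (?Y l \<omega> \<bullet> state_gradient k ?X l \<omega>)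
        + c\<^sup>2 * pert_stage_cost k ?Y l \<omega> + (if l = k then ?r \<omega> else 0))
      + (terminal_cost k (?X N) \<omega> + (2 * c) * (?Y N \<omega> \<bullet> Z N \<omega>) + c\<^sup>2 * pert_terminal_cost k (?Y N) \<omega>))"
    unfolding u'_def
    by (intro ceq_add ceq_sum ceq_stage_cost_perturbed \<xi> u v N
        ceq_terminal_cost_perturbed[OF X Y X'[unfolded u'_def] k e[unfolded u'_def] ZN Z(1)]) auto
  also have "\<dots> = (\<lambda>\<omega>. ?T \<omega> + (2 * c) * (?lin \<omega> + ?D \<omega>) + c\<^sup>2 * ?S \<omega>)"
  proof
    fix \<omega>
    have "(\<Sum>l = k..<N. if l = k then ?r \<omega> else 0) = ?r \<omega>" using k by simp
    then show "(\<Sum>l = k..<N. stage_cost k ?X u l \<omega>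
        + (2 * c) * (?Y l \<omega> \<bullet> state_gradient k ?X l \<omega>)
        + c\<^sup>2 * pert_stage_cost k ?Y l \<omega> + (if l = k then ?r \<omega> else 0))
      + (terminal_cost k (?X N) \<omega> + (2 * c) * (?Y N \<omega> \<bullet> Z N \<omega>) + c\<^sup>2 * pert_terminal_cost k (?Y N) \<omega>)
      = ?T \<omega> + (2 * c) * (?lin \<omega> + ?D \<omega>) + c\<^sup>2 * ?S \<omega>"
      unfolding sum.distrib sum_distrib_left[symmetric] by (simp only: distrib_left add_ac)
  qed
  \<comment> \<open>Duality replaces the response in the linear term by \<open>v\<close>; together
    with the contribution \<open>?lin\<close> of the control weights this gives the
    residual.\<close>
  also have "ceq k \<dots> (\<lambda>\<omega>. cost k \<xi> u \<omega> + (2 * c) * (?lin \<omega> + ?D' \<omega>) + c\<^sup>2 * pert_cost k v \<omega>)"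
    by (intro ceq_add ceq_cmult ceq_refl[OF lin] ceq_sym[OF ceq_cost(1)[OF \<xi> u k]]
        ceq_sym[OF ceq_pert_cost(1)[OF v k]] ceq_duality[OF sol' v N(3,2)] N)
  also have "(\<lambda>\<omega>. ?lin \<omega> + ?D' \<omega>) = (\<lambda>\<omega>. v \<omega> \<bullet> stationarity_residual k u Z \<omega>)"
    by (simp only: stationarity_residual_def inner_add_right add_ac)
  finally show ?thesis unfolding u'_def[symmetric]
  proof (rule AE_eq_if_ceq)
    show "cost k \<xi> u' \<in> borel_measurable (Filt k)" by (rule ceq_cost[OF \<xi> u' k])
    show "(\<lambda>\<omega>. cost k \<xi> u \<omega> + (2 * c) * (v \<omega> \<bullet> stationarity_residual k u Z \<omega>) + c\<^sup>2 * pert_cost k v \<omega>)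
        \<in> borel_measurable (Filt k)"
      by (intro borel_measurable_add borel_measurable_times borel_measurable_const borel_measurable_inner
          ceq_cost(2)[OF \<xi> u k] ceq_pert_cost(2)[OF v k] L2_measurable[OF v] L2_measurable[OF res])
  qed (rule N)
qed

section \<open>Optimality at one time and the equilibrium\<close>

lemma equilibrium_imp_stationary_convex:
  assumes sol: "fbsde_solution k \<xi> u X Z"
    and \<xi>: "\<xi> \<in> L2 k" and u: "u \<in> L2_proc {k..<N}" and k: "k < N"
    and opt: "\<And>v. v \<in> L2 k \<Longrightarrow> AE \<omega> in M. cost k \<xi> u \<omega> \<le> cost k \<xi> (u(k := v)) \<omega>"
  shows "stationary k u Z" "convexity k"
proof -
  have uk: "u k \<in> L2 k" and Z: "Z (Suc k) \<in> L2 (Suc k)"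
    using u k sol by (auto simp: L2_proc_def fbsde_solution_def)
  note res = L2_stationarity_residual[where u = u and Z = Z, OF uk Z k]
  let ?S = "stationarity_residual k u Z"
  have var: "AE \<omega> in M. 0 \<le> (2 * c) * (v \<omega> \<bullet> ?S \<omega>) + c\<^sup>2 * pert_cost k v \<omega>" if v: "v \<in> L2 k" for v c
    using opt[OF L2_add[OF uk L2_scaleR[OF v less_imp_le[OF k]] less_imp_le[OF k]], of c]
      cost_perturbed[OF sol \<xi> u v k, of c]
    by eventually_elim linarith
  \<comment> \<open>The residual is an admissible direction because it lies in \<open>L2 k\<close>,
    and countably many step sizes share one null set.\<close>
  have "AE \<omega> in M. \<forall>n. 0 \<le> (2 * - inverse (real (Suc n))) * (?S \<omega> \<bullet> ?S \<omega>)
      + (- inverse (real (Suc n)))\<^sup>2 * pert_cost k ?S \<omega>"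
    unfolding AE_all_countable using var[OF res] by blast
  then have S: "AE \<omega> in M. ?S \<omega> = 0"
  proof eventually_elim
    case (elim \<omega>)
    \<comment> \<open>The variation inequality divided by the positive number
      \<open>inverse (real (Suc n))\<close>. At a fixed point the right-hand side tends to 0, which
      forces the residual to vanish there.\<close>
    have "2 * (?S \<omega> \<bullet> ?S \<omega>) \<le> inverse (real (Suc n)) * pert_cost k ?S \<omega>" for n
    proof -
      have "0 \<le> inverse (real (Suc n)) * (inverse (real (Suc n)) * pert_cost k ?S \<omega> - 2 * (?S \<omega> \<bullet> ?S \<omega>))"
        using elim[rule_format, of n] by (simp add: power2_eq_square algebra_simps)
      then show ?thesis by (simp add: zero_le_mult_iff)
    qed
    moreover have "(\<lambda>n. inverse (real (Suc n)) * pert_cost k ?S \<omega>) \<longlonglongrightarrow> 0 * pert_cost k ?S \<omega>"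
      by (intro tendsto_mult_right LIMSEQ_inverse_real_of_nat)
    ultimately have "2 * (?S \<omega> \<bullet> ?S \<omega>) \<le> 0 * pert_cost k ?S \<omega>"
      by (intro LIMSEQ_le_const) auto
    then show ?case by (metis inner_ge_zero inner_eq_zero_iff mult_zero_left order_antisym
        mult_le_0_iff zero_less_numeral not_le)
  qed
  then show "stationary k u Z" by (simp add: stationary_iff)
  show "convexity k"
    unfolding convexity_def
  proof
    fix v :: "'a \<Rightarrow> real ^ 'm" assume "v \<in> L2 k"
    \<comment> \<open>With zero residual the first-order term drops out, and \<open>c = 1\<close>
      leaves the quadratic coefficient.\<close>
    from var[OF this, of 1] S show "AE \<omega> in M. 0 \<le> pert_cost k v \<omega>"
      by eventually_elim simp
  qed
qed

text \<open>Any competitor \<open>v\<close> is \<open>u k\<close> plus the direction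
  \<open>v - u k\<close>, so the exact expansion at \<open>c = 1\<close> suffices.\<close>

lemma stationary_convex_imp_optimal:
  assumes sol: "fbsde_solution k \<xi> u X Z"
    and \<xi>: "\<xi> \<in> L2 k" and u: "u \<in> L2_proc {k..<N}" and k: "k < N"
    and "stationary k u Z" "convexity k" and v: "v \<in> L2 k"
  shows "AE \<omega> in M. cost k \<xi> u \<omega> \<le> cost k \<xi> (u(k := v)) \<omega>"
proof -
  have uk: "u k \<in> L2 k" using u k by (auto simp: L2_proc_def)
  have d: "(\<lambda>\<omega>. v \<omega> - u k \<omega>) \<in> L2 k" by (rule L2_diff[OF v uk less_imp_le[OF k]])
  have S: "AE \<omega> in M. stationarity_residual k u Z \<omega> = 0"
    using assms(5) by (simp add: stationary_iff)
  have C: "AE \<omega> in M. 0 \<le> pert_cost k (\<lambda>\<omega>. v \<omega> - u k \<omega>) \<omega>"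
    using assms(6) d by (simp add: convexity_def)
  from cost_perturbed[OF sol \<xi> u d k, of 1] S C show ?thesis
    by eventually_elim simp
qed

text \<open>For a fixed pair the conditions at different times \<open>k\<close> are independent of
  one another, so the equivalence is proved for each \<open>k\<close>. Having the same pair on both
  sides yields the existence claim and the final assertion together.\<close>

lemma open_loop_equilibrium_pair_iff:
  assumes t: "t < N"
  shows "open_loop_equilibrium_pair t x X u \<longleftrightarrow> fbsde_conditions t x X u"
proof -
  have *: "(\<forall>v\<in>L2 k. AE \<omega> in M. cost k (X k) u \<omega> \<le> cost k (X k) (u(k := v)) \<omega>) \<longleftrightarrow>
      (\<exists>Xk Zk. fbsde_solution k (X k) u Xk Zk \<and> stationary k u Zk) \<and> convexity k"
    if u: "u \<in> L2_proc {t..<N}" and X: "equilibrium_state t x u X" and k: "k \<in> {t..<N}" for k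
  proof -
    have u': "u \<in> L2_proc {k..<N}" and \<xi>: "X k \<in> L2 k" and kN: "k < N"
      using u X k by (auto simp: L2_proc_def equilibrium_state_def)
    \<comment> \<open>This solution is used to pass from optimality to the forward-backward
      conditions; conversely, any given solution that satisfies stationarity will do.\<close>
    obtain Z where Z: "fbsde_solution k (X k) u (state k (X k) u) Z"
      using ex_fbsde_solution[OF \<xi> u' kN] by blast
    show ?thesis
      using equilibrium_imp_stationary_convex[OF Z \<xi> u' kN] Z
        stationary_convex_imp_optimal[OF _ \<xi> u' kN] by blast
  qed
  show ?thesis
    unfolding open_loop_equilibrium_pair_def fbsde_conditions_def using * by blast
qed

end

theorem theorem2p3:
  fixes M :: "'a measure" and N t :: nat and w :: "nat \<Rightarrow> 'a \<Rightarrow> real"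
    and P :: "('n::finite, 'm::finite) lq_data"
    and x :: "'a \<Rightarrow> real ^ 'n"
  assumes "lq_problem M N w P"
    and "t < N"
    and "x \<in> lq_problem.L2 M w t"
  shows "((\<exists>X u. lq_problem.open_loop_equilibrium_pair M N w P t x X u) \<longleftrightarrow>
          (\<exists>X u. lq_problem.fbsde_conditions M N w P t x X u)) \<and>
         (\<forall>X u. lq_problem.fbsde_conditions M N w P t x X u \<longrightarrow>
            lq_problem.open_loop_equilibrium_pair M N w P t x X u)"
  using lq_problem.open_loop_equilibrium_pair_iff[OF assms(1,2)] by blast

end
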